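(* Let $\Omega$ be a $\sigma$-compact metric space, $\nu$ a probability measure on the Borel $\sigma$-field of $\Omega$, $\mathcal{C}\in\mathbb{C}^{I_1\times\cdots\times I_N\times I_1\times\cdots\times I_N}$ a Hermitian tensor and $\tau\mapsto\mathcal{D}_\tau$ a continuous map from $\Omega$ into Hermitian tensors of the same size with $\sup\{\|\mathcal{D}_\tau\|:\tau\in\Omega\}<\infty$, all of Hermitian rank $r$. Then the following are equivalent: (i) $\vec\lambda(\mathcal{C})\prec\int_{\Omega^r}\vec\lambda(\mathcal{D}_\tau)\,d\nu^r(\tau)$; (ii) for every convex function $f:\mathbb{R}\to[0,\infty)$ and every unitarily invariant norm $\|\cdot\|_\rho$, $\|f(\mathcal{C})\|_\rho\le\int_\Omega\|f(\mathcal{D}_\tau)\|_\rho\,d\nu(\tau)$.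
   Context: Einstein product, conjugate transpose and Hermitian tensors: $(\mathcal{A}\star_N\mathcal{B})_{i,k}=\sum_j a_{i,j}b_{j,k}$ over multi-indices, $(\mathcal{A}^H)_{j,i}=\overline{a_{i,j}}$. A Hermitian tensor decomposes as $\mathcal{H}=\sum_{i=1}^r\lambda_i\mathcal{U}_i\otimes\mathcal{U}_i^H$ with real Hermitian eigenvalues and orthonormal $\mathcal{U}_i$; $r$ (minimal) is the Hermitian rank; $\vec\lambda(\mathcal{H})$ lists the Hermitian eigenvalues in decreasing order; $f(\mathcal{H})=\sum_i f(\lambda_i)\mathcal{U}_i\otimes\mathcal{U}_i^H$; $|\mathcal{A}|=(\mathcal{A}^H\star_N\mathcal{A})^{1/2}$; $\|\cdot\|$ is the operator norm. $\int_{\Omega^r}\vec\lambda(\mathcal{D}_\tau)d\nu^r(\tau)=\left(\int_\Omega\lambda_i(\mathcal{D}_\tau)d\nu(\tau)\right)_{i=1}^r$. For decreasingly ordered $\mathbf{x},\mathbf{y}\in\mathbb{R}^r$, $\mathbf{x}\prec\mathbf{y}$ means $\sum_{i=1}^kx_i\le\sum_{i=1}^ky_i$ for $k<r$ and equality for $k=r$. A unitarily invariant norm satisfies $\|\mathcal{U}\mathcal{H}\|_\rho=\|\mathcal{H}\mathcal{U}\|_\rho=\|\mathcal{H}\|_\rho$ for unitary $\mathcal{U}$ and $\|\mathcal{H}\|_\rho=\rho(\vec\lambda(|\mathcal{H}|))$ for a symmetric gauge function $\rho$. *)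

theory Defs
  imports "HOL-Probability.Probability"
begin

text \<open>Even-order tensors in C^(I1 x ... x IN x I1 x ... x IN) are modelled as functions
  'i => 'i => complex, where the finite type 'i stands for the multi-index set
  [I1] x ... x [IN]; order-N tensors are functions 'i => complex.\<close>

type_synonym 'i tensor = "'i \<Rightarrow> 'i \<Rightarrow> complex"
type_synonym 'i vtensor = "'i \<Rightarrow> complex"

definition einstein_prod :: "'i::finite tensor \<Rightarrow> 'i tensor \<Rightarrow> 'i tensor" where
  "einstein_prod A B = (\<lambda>i k. \<Sum>j\<in>UNIV. A i j * B j k)"

definition ctrans :: "'i tensor \<Rightarrow> 'i tensor" where
  "ctrans A = (\<lambda>j i. cnj (A i j))"

definition hermitian_t :: "'i tensor \<Rightarrow> bool" where
  "hermitian_t H \<longleftrightarrow> ctrans H = H"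

definition outer_h :: "'i vtensor \<Rightarrow> 'i vtensor \<Rightarrow> 'i tensor" where
  "outer_h U V = (\<lambda>i j. U i * cnj (V j))"

definition tinner :: "'i::finite vtensor \<Rightarrow> 'i vtensor \<Rightarrow> complex" where
  "tinner U V = (\<Sum>i\<in>UNIV. U i * cnj (V i))"

definition orthonormal_t :: "'i::finite vtensor list \<Rightarrow> bool" where
  "orthonormal_t us \<longleftrightarrow> (\<forall>a<length us. \<forall>b<length us.
      tinner (us ! a) (us ! b) = (if a = b then 1 else 0))"

definition herm_decomp :: "'i::finite tensor \<Rightarrow> real list \<Rightarrow> 'i vtensor list \<Rightarrow> bool" where
  "herm_decomp H ls us \<longleftrightarrow> length ls = length us \<and> orthonormal_t us \<and>
     H = (\<lambda>i j. \<Sum>k<length ls. complex_of_real (ls ! k) * outer_h (us ! k) (us ! k) i j)"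

definition herm_rank :: "'i::finite tensor \<Rightarrow> nat" where
  "herm_rank H = (LEAST r. \<exists>ls us. length ls = r \<and> herm_decomp H ls us)"

definition herm_eigs :: "'i::finite tensor \<Rightarrow> real list" where
  "herm_eigs H = (THE ls. sorted_wrt (\<ge>) ls \<and> length ls = herm_rank H \<and>
                      (\<exists>us. herm_decomp H ls us))"

definition herm_fun :: "(real \<Rightarrow> real) \<Rightarrow> 'i::finite tensor \<Rightarrow> 'i tensor" where
  "herm_fun f H = (let p = (SOME p. herm_decomp H (fst p) (snd p) \<and> length (fst p) = herm_rank H)
     in (\<lambda>i j. \<Sum>k<length (fst p).
            complex_of_real (f (fst p ! k)) * outer_h (snd p ! k) (snd p ! k) i j))"

definition tabs :: "'i::finite tensor \<Rightarrow> 'i tensor" where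
  "tabs A = herm_fun sqrt (einstein_prod (ctrans A) A)"

definition tapply :: "'i::finite tensor \<Rightarrow> 'i vtensor \<Rightarrow> 'i vtensor" where
  "tapply A x = (\<lambda>i. \<Sum>j\<in>UNIV. A i j * x j)"

definition tvnorm :: "'i::finite vtensor \<Rightarrow> real" where
  "tvnorm x = sqrt (\<Sum>i\<in>UNIV. (cmod (x i))\<^sup>2)"

definition opnorm_t :: "'i::finite tensor \<Rightarrow> real" where
  "opnorm_t A = Sup {tvnorm (tapply A x) | x. tvnorm x \<le> 1}"

definition sym_gauge :: "(real list \<Rightarrow> real) \<Rightarrow> nat \<Rightarrow> bool" where
  "sym_gauge \<rho> n \<longleftrightarrow>
     (\<forall>x. length x = n \<longrightarrow> \<rho> x \<ge> 0 \<and> (\<rho> x = 0 \<longleftrightarrow> (\<forall>a\<in>set x. a = 0))) \<and>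
     (\<forall>x c. length x = n \<longrightarrow> \<rho> (map ((*) c) x) = \<bar>c\<bar> * \<rho> x) \<and>
     (\<forall>x y. length x = n \<longrightarrow> length y = n \<longrightarrow> \<rho> (map2 (+) x y) \<le> \<rho> x + \<rho> y) \<and>
     (\<forall>x y. length x = n \<longrightarrow> mset y = mset x \<longrightarrow> \<rho> y = \<rho> x) \<and>
     (\<forall>x e. length x = n \<longrightarrow> length e = n \<longrightarrow> set e \<subseteq> {-1, 1} \<longrightarrow>
          \<rho> (map2 (*) e x) = \<rho> x)"

definition ui_norm :: "(real list \<Rightarrow> real) \<Rightarrow> 'i::finite tensor \<Rightarrow> real" where
  "ui_norm \<rho> H = \<rho> (herm_eigs (tabs H) @ replicate (CARD('i) - length (herm_eigs (tabs H))) 0)"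

text \<open>majorization x \<prec> y for (decreasingly ordered) vectors of the same length\<close>
definition majorized :: "real list \<Rightarrow> real list \<Rightarrow> bool" where
  "majorized x y \<longleftrightarrow> length x = length y \<and>
     (\<forall>k. 1 \<le> k \<and> k < length x \<longrightarrow> sum_list (take k x) \<le> sum_list (take k y)) \<and>
     sum_list x = sum_list y"

definition sigma_compact_space :: "'a::metric_space itself \<Rightarrow> bool" where
  "sigma_compact_space _ \<longleftrightarrow> (\<exists>K :: nat \<Rightarrow> 'a set. (\<forall>n. compact (K n)) \<and> (\<Union>n. K n) = UNIV)"

end

theory Submission
  imports Defs "HOL-Combinatorics.Permutations" "HOL-Computational_Algebra.Polynomial"
begin

text \<open>For a nonnegative \<open>f\<close>, the norm of \<open>f(H)\<close> is \<open>\<rho>\<close> applied to \<open>f(\<lambda>\<^sub>1), \<dots>, f(\<lambda>\<^sub>r)\<close> padded by zeros, a convex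
  symmetric function \<open>\<phi>\<close> of the eigenvalues. (i) implies (ii): bound \<open>\<phi>\<close> below by its tangent at the
  eigenvalues of \<open>C\<close>, permute the argument so that the tangent vector is decreasing, integrate, and compare
  the linear terms by the rearrangement inequality and summation by parts.
  (ii) implies (i): for large \<open>B\<close>, the Ky Fan \<open>k\<close>-norm with \<open>f(x) = max (x + B) 0\<close> gives the \<open>k\<close>-th partial
  sum inequality, and the \<open>r\<close>-norm with \<open>f(x) = max (B - x) 0\<close> gives the reverse inequality of the totals.
  The power sums of the eigenvalues are the traces of the powers of \<open>H\<close>. They determine the nonzero
  eigenvalues with multiplicities, whence rank and eigenvalue list are well defined, and they show that each
  eigenvalue is a measurable function of \<open>\<tau>\<close>.\<close>

section \<open>Eigenvalues from moments\<close>

lemma orthonormal_t_Cons: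
  "orthonormal_t (u # us) \<longleftrightarrow> tinner u u = 1 \<and> (\<forall>v\<in>set us. tinner u v = 0 \<and> tinner v u = 0) \<and> orthonormal_t us"
proof
  assume o: "orthonormal_t (u # us)"
  have "tinner u v = 0 \<and> tinner v u = 0" if v: "v \<in> set us" for v
  proof -
    obtain k where k: "k < length us" "v = us ! k" using v by (auto simp: in_set_conv_nth)
    have "tinner ((u#us)!0) ((u#us)!Suc k) = 0" "tinner ((u#us)!Suc k) ((u#us)!0) = 0"
      using o k unfolding orthonormal_t_def by (metis Suc_less_eq Zero_not_Suc length_Cons zero_less_Suc)+
    then show ?thesis using k by simp
  qed
  moreover have "tinner u u = 1"
    using o unfolding orthonormal_t_def by (metis length_Cons nth_Cons_0 zero_less_Suc)
  moreover have "orthonormal_t us"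
    unfolding orthonormal_t_def
  proof (intro allI impI)
    fix a b assume "a < length us" "b < length us"
    then have "tinner ((u#us)!Suc a) ((u#us)!Suc b) = (if Suc a = Suc b then 1 else 0)"
      using o unfolding orthonormal_t_def by (metis Suc_less_eq length_Cons)
    then show "tinner (us ! a) (us ! b) = (if a = b then 1 else 0)" by simp
  qed
  ultimately show "tinner u u = 1 \<and> (\<forall>v\<in>set us. tinner u v = 0 \<and> tinner v u = 0) \<and> orthonormal_t us"
    by blast
next
  assume "tinner u u = 1 \<and> (\<forall>v\<in>set us. tinner u v = 0 \<and> tinner v u = 0) \<and> orthonormal_t us"
  then show "orthonormal_t (u # us)"
    unfolding orthonormal_t_def by (auto simp: nth_Cons split: nat.splits)
qed

lemma orthonormal_t_Nil [simp]: "orthonormal_t []"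
  by (simp add: orthonormal_t_def)

lemma tinner_nth:
  assumes "orthonormal_t us" "a < length us" "b < length us"
  shows "tinner (us ! a) (us ! b) = (if a = b then 1 else 0)"
  using assms unfolding orthonormal_t_def by blast

lemma herm_decomp_nth:
  "herm_decomp H ls us \<Longrightarrow> H i j = (\<Sum>k<length ls. complex_of_real (ls ! k) * ((us ! k) i * cnj ((us ! k) j)))"
  by (simp add: herm_decomp_def outer_h_def)

lemma herm_decompI:
  assumes "length ls = length us" "orthonormal_t us"
    "\<And>i j. H i j = (\<Sum>k<length ls. complex_of_real (ls ! k) * ((us ! k) i * cnj ((us ! k) j)))"
  shows "herm_decomp H ls us"
  using assms by (auto simp: herm_decomp_def outer_h_def fun_eq_iff)

lemma herm_decomp_imp_hermitian: "herm_decomp H ls us \<Longrightarrow> hermitian_t H"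
  unfolding hermitian_t_def ctrans_def
  by (auto simp: fun_eq_iff herm_decomp_nth mult.commute intro!: sum.cong)

lemma sum_delta_mult:
  assumes "k < (n::nat)"
  shows "(\<Sum>l<n. f l * (if l = k then 1 else 0 :: 'b::semiring_1)) = f k"
    and "(\<Sum>l<n. f l * (if k = l then 1 else 0 :: 'b::semiring_1)) = f k"
  using assms by (auto simp: if_distrib [of "(*) _"] cong: if_cong)

text \<open>Orthonormality collapses the double sum over pairs of rank-one terms to its diagonal,
  which is why both factors must share the list \<open>us\<close>.\<close>

lemma herm_decomp_mult:
  fixes A B :: "'i::finite tensor"
  assumes A: "herm_decomp A as us" and B: "herm_decomp B bs us"
  shows "herm_decomp (einstein_prod A B) (map2 (*) as bs) us"
proof (rule herm_decompI)
  have len: "length as = length us" "length bs = length us"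
    using A B by (auto simp: herm_decomp_def)
  have on: "orthonormal_t us" using A by (simp add: herm_decomp_def)
  show "length (map2 (*) as bs) = length us" using len by simp
  show "orthonormal_t us" by fact
  fix i j
  have "einstein_prod A B i j =
    (\<Sum>m\<in>UNIV. \<Sum>k<length us. \<Sum>l<length us. of_real (as!k) * of_real (bs!l) * (us!k) i * cnj ((us!l) j) * ((us!l) m * cnj ((us!k) m)))"
    unfolding einstein_prod_def herm_decomp_nth[OF A] herm_decomp_nth[OF B] len sum_product
    by (intro sum.cong refl) (simp only: mult_ac)
  also have "\<dots> = (\<Sum>k<length us. \<Sum>l<length us. of_real (as!k) * of_real (bs!l) * (us!k) i * cnj ((us!l) j) * tinner (us!l) (us!k))"
    unfolding tinner_def sum_distrib_left
    by (subst sum.swap, rule sum.cong[OF refl], subst sum.swap, rule refl)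
  also have "\<dots> = (\<Sum>k<length us. \<Sum>l<length us. of_real (as!k) * of_real (bs!l) * (us!k) i * cnj ((us!l) j) * (if l = k then 1 else 0))"
    by (intro sum.cong refl) (simp add: tinner_nth[OF on])
  also have "\<dots> = (\<Sum>k<length us. of_real (as!k) * of_real (bs!k) * (us!k) i * cnj ((us!k) j))"
    by (intro sum.cong refl) (simp only: sum_delta_mult lessThan_iff)
  finally show "einstein_prod A B i j =
     (\<Sum>k<length (map2 (*) as bs). complex_of_real (map2 (*) as bs ! k) * ((us ! k) i * cnj ((us ! k) j)))"
    using len by (simp add: algebra_simps)
qed

text \<open>The powers are shifted by one, as the zeroth power would see the kernel.\<close>

primrec tpow_Suc :: "'i::finite tensor \<Rightarrow> nat \<Rightarrow> 'i tensor" where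
  "tpow_Suc H 0 = H"
| "tpow_Suc H (Suc m) = einstein_prod H (tpow_Suc H m)"

definition ttrace :: "'i::finite tensor \<Rightarrow> complex" where
  "ttrace A = (\<Sum>i\<in>UNIV. A i i)"

lemma herm_decomp_tpow_Suc:
  "herm_decomp H ls us \<Longrightarrow> herm_decomp (tpow_Suc H m) (map (\<lambda>x. x ^ Suc m) ls) us"
proof (induction m)
  case (Suc m)
  have "map2 (*) ls (map (\<lambda>x. x ^ Suc m) ls) = map (\<lambda>x. x ^ Suc (Suc m)) ls"
    by (simp add: zip_map2 comp_def zip_same_conv_map)
  then show ?case using herm_decomp_mult[OF Suc.prems Suc.IH[OF Suc.prems]] by simp
qed simp

lemma ttrace_herm_decomp:
  assumes "herm_decomp H ls us"
  shows "ttrace H = of_real (sum_list ls)"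
proof -
  have on: "orthonormal_t us" and len: "length us = length ls"
    using assms by (auto simp: herm_decomp_def)
  have "ttrace H = (\<Sum>k<length ls. of_real (ls!k) * tinner (us!k) (us!k))"
    unfolding ttrace_def herm_decomp_nth[OF assms] tinner_def sum_distrib_left
    by (subst sum.swap) simp
  also have "\<dots> = (\<Sum>k<length ls. of_real (ls!k))"
    by (intro sum.cong refl) (simp add: tinner_nth[OF on] len)
  finally show ?thesis by (simp add: sum_list_sum_nth atLeast0LessThan)
qed

text \<open>The right-hand side does not mention the decomposition, which yields uniqueness of the
  eigenvalues; it is also the real part of a polynomial in the entries of \<open>H\<close>, which
  yields their measurability.\<close>

lemma moment_eq_trace:
  assumes "herm_decomp H ls us"
  shows "(\<Sum>x\<leftarrow>ls. x ^ Suc m) = Re (ttrace (tpow_Suc H m))"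
  using ttrace_herm_decomp[OF herm_decomp_tpow_Suc[OF assms, of m]] by simp

text \<open>Without a constant term, the sum of \<open>p\<close> over a list depends only on the
  moments of order at least one.\<close>

lemma sum_list_poly:
  fixes p :: "real poly"
  assumes "poly p 0 = 0"
  shows "(\<Sum>x\<leftarrow>ls. poly p x) = (\<Sum>m<degree p. coeff p (Suc m) * (\<Sum>x\<leftarrow>ls. x ^ Suc m))"
proof -
  have "poly p x = (\<Sum>m<degree p. coeff p (Suc m) * x ^ Suc m)" for x
  proof -
    have "poly p x = (\<Sum>m<Suc (degree p). coeff p m * x ^ m)"
      by (simp add: poly_altdef lessThan_Suc_atMost)
    also have "\<dots> = coeff p 0 * x ^ 0 + (\<Sum>m<degree p. coeff p (Suc m) * x ^ Suc m)"
      by (rule sum.lessThan_Suc_shift)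
    finally show ?thesis using assms by (simp add: poly_0_coeff_0)
  qed
  then have "(\<Sum>x\<leftarrow>ls. poly p x) = (\<Sum>x\<leftarrow>ls. \<Sum>m<degree p. coeff p (Suc m) * x ^ Suc m)"
    by simp
  also have "\<dots> = (\<Sum>m<degree p. coeff p (Suc m) * (\<Sum>x\<leftarrow>ls. x ^ Suc m))"
    by (induction ls) (simp_all add: sum.distrib algebra_simps)
  finally show ?thesis .
qed

text \<open>A polynomial vanishing at 0 and at every entry other than \<open>c\<close> isolates the multiplicity of \<open>c\<close>.\<close>

lemma moments_determine_mset:
  fixes ls ls' :: "real list"
  assumes "\<And>m. (\<Sum>x\<leftarrow>ls. x ^ Suc m) = (\<Sum>x\<leftarrow>ls'. x ^ Suc m)"
  shows "filter_mset (\<lambda>x. x \<noteq> 0) (mset ls) = filter_mset (\<lambda>x. x \<noteq> 0) (mset ls')"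
proof (rule multiset_eqI)
  fix c
  show "count {#x \<in># mset ls. x \<noteq> 0#} c = count {#x \<in># mset ls'. x \<noteq> 0#} c"
  proof (cases "c = 0")
    case False
    define S where "S = insert 0 (set ls \<union> set ls') - {c}"
    define p where "p = (\<Prod>a\<in>S. [:- a, 1:])"
    have p: "poly p x = (\<Prod>a\<in>S. x - a)" for x
      by (simp add: p_def poly_prod)
    have fin: "finite S" by (simp add: S_def)
    have p0: "poly p x = 0" if "x \<in> S" for x
      using that fin by (auto simp: p)
    have pc: "poly p c \<noteq> 0" using fin by (auto simp: p S_def)
    have 1: "(\<Sum>x\<leftarrow>xs. poly p x) = poly p c * real (count (mset xs) c)"
      if "set xs \<subseteq> set ls \<union> set ls'" for xs
      using that
    proof (induction xs)
      case (Cons a xs)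
      then show ?case using p0[of a] by (cases "a = c") (auto simp: S_def algebra_simps)
    qed simp
    have "poly p 0 = 0" using False by (intro p0) (auto simp: S_def)
    then have "(\<Sum>x\<leftarrow>ls. poly p x) = (\<Sum>x\<leftarrow>ls'. poly p x)"
      by (simp only: sum_list_poly assms)
    then show ?thesis using 1[of ls] 1[of ls'] pc by simp
  qed simp
qed

lemma herm_decomp_mset_unique:
  assumes "herm_decomp H ls us" "herm_decomp H ls' us'"
  shows "filter_mset (\<lambda>x. x \<noteq> 0) (mset ls) = filter_mset (\<lambda>x. x \<noteq> 0) (mset ls')"
  by (rule moments_determine_mset) (simp only: moment_eq_trace[OF assms(1)] moment_eq_trace[OF assms(2)])

text \<open>Splits off one rank-one term, for inductions along a decomposition and for building one
  vector by vector.\<close>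

lemma herm_decomp_Cons_iff:
  "herm_decomp H (l # ls) (u # us) \<longleftrightarrow>
     herm_decomp (\<lambda>i j. H i j - of_real l * (u i * cnj (u j))) ls us \<and> tinner u u = 1 \<and>
     (\<forall>v\<in>set us. tinner u v = 0 \<and> tinner v u = 0)"
  unfolding herm_decomp_def orthonormal_t_Cons length_Cons sum.lessThan_Suc_shift
  by (auto simp: outer_h_def fun_eq_iff algebra_simps)

text \<open>The inclusion of the vectors strengthens the induction: it keeps the head vector
  orthogonal to those that survive.\<close>

lemma herm_decomp_filter:
  assumes "herm_decomp H ls us"
  shows "\<exists>us'. herm_decomp H (filter (\<lambda>x. x \<noteq> 0) ls) us' \<and> set us' \<subseteq> set us"
  using assms
proof (induction ls arbitrary: us H)
  case Nil
  then show ?case by auto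
next
  case (Cons l ls)
  from Cons.prems obtain u us0 where us: "us = u # us0"
    by (cases us) (auto simp: herm_decomp_def)
  from Cons.prems have d: "herm_decomp (\<lambda>i j. H i j - of_real l * (u i * cnj (u j))) ls us0"
    and o: "tinner u u = 1" "\<forall>v\<in>set us0. tinner u v = 0 \<and> tinner v u = 0"
    by (auto simp: us herm_decomp_Cons_iff)
  from Cons.IH[OF d] obtain us' where us':
    "herm_decomp (\<lambda>i j. H i j - of_real l * (u i * cnj (u j))) (filter (\<lambda>x. x \<noteq> 0) ls) us'" "set us' \<subseteq> set us0" by blast
  show ?case
  proof (cases "l = 0")
    case True
    then show ?thesis using us' by (auto simp: us)
  next
    case False
    have "herm_decomp H (l # filter (\<lambda>x. x \<noteq> 0) ls) (u # us')"
      using us' o by (auto simp: herm_decomp_Cons_iff)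
    then show ?thesis using False us' by (intro exI[of _ "u # us'"]) (auto simp: us)
  qed
qed

lemma herm_decomp_permute:
  assumes "herm_decomp H ls us" "mset ls' = mset ls"
  shows "\<exists>us'. herm_decomp H ls' us'"
proof -
  obtain p where p: "p permutes {..<length ls}" "permute_list p ls = ls'"
    using mset_eq_permutation[OF assms(2)] by blast
  have len: "length us = length ls" and on: "orthonormal_t us"
    using assms by (auto simp: herm_decomp_def)
  have "herm_decomp H ls' (permute_list p us)"
  proof (rule herm_decompI)
    show "length ls' = length (permute_list p us)" using p(2) len by auto
    have "inj p" using p(1) by (simp add: permutes_inj)
    moreover have "p k < length ls" if "k < length ls" for k
      using permutes_in_image[OF p(1), of k] that by simp
    ultimately show "orthonormal_t (permute_list p us)"
      unfolding orthonormal_t_def by (auto simp: permute_list_nth p(1) len tinner_nth[OF on] inj_eq)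
    fix i j
    have "H i j = (\<Sum>k<length ls. complex_of_real (ls ! p k) * ((us ! p k) i * cnj ((us ! p k) j)))"
      unfolding herm_decomp_nth[OF assms(1)] by (rule sum.permute[OF p(1), unfolded comp_def])
    then show "H i j = (\<Sum>k<length ls'. complex_of_real (ls' ! k) *
       ((permute_list p us ! k) i * cnj ((permute_list p us ! k) j)))"
      using p len by (auto simp: permute_list_nth)
  qed
  then show ?thesis ..
qed

text \<open>Dropping the zero values attains the count. Every other decomposition has the same
  nonzero values, so it cannot be shorter.\<close>

lemma herm_rank_decomp:
  assumes "herm_decomp H ls us"
  shows "herm_rank H = size (filter_mset (\<lambda>x. x \<noteq> 0) (mset ls))"
  unfolding herm_rank_def
proof (rule Least_equality)
  show "\<exists>ls' us'. length ls' = size {#x \<in># mset ls. x \<noteq> 0#} \<and> herm_decomp H ls' us'"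
    using herm_decomp_filter[OF assms] by (metis mset_filter size_mset)
  fix r assume "\<exists>ls' us'. length ls' = r \<and> herm_decomp H ls' us'"
  then obtain ls' us' where "length ls' = r" "herm_decomp H ls' us'" by blast
  then show "size {#x \<in># mset ls. x \<noteq> 0#} \<le> r"
    using herm_decomp_mset_unique[OF assms] by (metis size_filter_mset_lesseq size_mset)
qed

lemma herm_decomp_minimal:
  assumes "herm_decomp H ls us" "length ls = herm_rank H"
  shows "0 \<notin> set ls"
proof -
  have "size (filter_mset (\<lambda>x. x \<noteq> 0) (mset ls)) = size (mset ls)"
    using assms herm_rank_decomp by fastforce
  \<comment> \<open>A submultiset of full size is the whole multiset.\<close>
  then have "filter_mset (\<lambda>x. x \<noteq> 0) (mset ls) = mset ls"
    by (metis mset_subset_eq_multiset_union_diff_commute multiset_filter_subset subset_mset.antisym_conv2 mset_subset_size nat_neq_iff)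
  then show ?thesis by (metis (mono_tags, lifting) filter_mset_eq_conv set_mset_mset)
qed

section \<open>The eigenvalue list and functions of a Hermitian tensor\<close>

lemma filter_mset_nonzero:
  "0 \<notin> set xs \<Longrightarrow> filter_mset (\<lambda>x. x \<noteq> 0) (mset xs) = mset xs"
  by (induction xs) auto

lemma sorted_wrt_ge_unique:
  fixes xs ys :: "'b::linorder list"
  assumes "sorted_wrt (\<ge>) xs" "sorted_wrt (\<ge>) ys" "mset xs = mset ys"
  shows "xs = ys"
proof -
  have "sorted (rev xs)" "sorted (rev ys)" using assms by (auto simp: sorted_wrt_rev)
  then have "rev xs = rev ys" using assms(3) by (metis mset_rev properties_for_sort)
  then show ?thesis by simp
qed

text \<open>The nonzero values of any decomposition in decreasing order meet the description in
  \<open>herm_eigs\<close>. A decomposition of minimal length has no zeros, so its values form the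
  same multiset, and sorting leaves no choice.\<close>

lemma herm_eigs_decomp:
  assumes d: "herm_decomp H ls us"
  shows "sorted_wrt (\<ge>) (herm_eigs H)" "length (herm_eigs H) = herm_rank H"
    "mset (herm_eigs H) = filter_mset (\<lambda>x. x \<noteq> 0) (mset ls)"
    "\<exists>us'. herm_decomp H (herm_eigs H) us'"
proof -
  define L where "L = rev (sort (filter (\<lambda>x. x \<noteq> 0) ls))"
  have L: "mset L = filter_mset (\<lambda>x. x \<noteq> 0) (mset ls)" by (simp add: L_def)
  have "sorted_wrt (\<ge>) L" by (simp add: L_def sorted_wrt_rev)
  moreover have len: "length L = herm_rank H"
    by (metis L herm_rank_decomp[OF d] size_mset)
  moreover have ex: "\<exists>us. herm_decomp H L us"
    using herm_decomp_filter[OF d] herm_decomp_permute L by (metis mset_filter)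
  moreover have "xs = L" if xs: "sorted_wrt (\<ge>) xs" "length xs = herm_rank H" "\<exists>us. herm_decomp H xs us" for xs
  proof -
    obtain us' where u: "herm_decomp H xs us'" using xs by blast
    have "0 \<notin> set xs" using herm_decomp_minimal[OF u] xs by simp
    then have "mset xs = filter_mset (\<lambda>x. x \<noteq> 0) (mset xs)" by (simp add: filter_mset_nonzero)
    then have "mset xs = mset L" using herm_decomp_mset_unique[OF u d] L by simp
    then show ?thesis using xs \<open>sorted_wrt (\<ge>) L\<close> sorted_wrt_ge_unique by blast
  qed
  ultimately have "herm_eigs H = L"
    unfolding herm_eigs_def by (intro the_equality) blast+
  then show "sorted_wrt (\<ge>) (herm_eigs H)" "length (herm_eigs H) = herm_rank H"
    "mset (herm_eigs H) = filter_mset (\<lambda>x. x \<noteq> 0) (mset ls)" "\<exists>us'. herm_decomp H (herm_eigs H) us'"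
    using \<open>sorted_wrt (\<ge>) L\<close> len L ex by blast+
qed

text \<open>\<open>herm_fun\<close> chooses its minimal decomposition by \<open>SOME\<close>, so the
  order of the values is unknown; symmetric gauges see only their multiset. As \<open>f\<close> may
  vanish at an eigenvalue, the resulting decomposition need not be minimal.\<close>

lemma herm_fun_decomp:
  assumes d: "herm_decomp H ls us"
  shows "\<exists>ls' us'. herm_decomp (herm_fun f H) (map f ls') us' \<and> mset ls' = mset (herm_eigs H)"
proof -
  define p where "p = (SOME p. herm_decomp H (fst p) (snd p) \<and> length (fst p) = herm_rank H)"
  have "\<exists>p. herm_decomp H (fst p) (snd p) \<and> length (fst p) = herm_rank H"
    using herm_eigs_decomp[OF d] by (metis fst_conv snd_conv)
  then have p: "herm_decomp H (fst p) (snd p)" "length (fst p) = herm_rank H"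
    unfolding p_def by (metis (mono_tags, lifting) someI_ex)+
  have "0 \<notin> set (fst p)" using herm_decomp_minimal p by blast
  then have "mset (fst p) = filter_mset (\<lambda>x. x \<noteq> 0) (mset (fst p))"
    by (simp add: filter_mset_nonzero)
  then have "mset (fst p) = mset (herm_eigs H)"
    using herm_eigs_decomp(3)[OF p(1)] by simp
  moreover have "herm_decomp (herm_fun f H) (map f (fst p)) (snd p)"
    using p(1) unfolding herm_fun_def Let_def p_def[symmetric]
    by (intro herm_decompI) (auto simp: herm_decomp_def outer_h_def)
  ultimately show ?thesis by blast
qed

text \<open>Multiplying \<open>A\<close> by itself squares its values, and the square root undoes
  this as they are nonnegative; only zeros are lost, because \<open>herm_eigs\<close> omits
  them.\<close>

lemma herm_eigs_tabs:
  assumes d: "herm_decomp A as us" and nn: "\<forall>a\<in>set as. 0 \<le> a"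
  shows "mset (herm_eigs (tabs A)) = filter_mset (\<lambda>x. x \<noteq> 0) (mset as)"
proof -
  have "ctrans A = A" using herm_decomp_imp_hermitian[OF d] by (simp add: hermitian_t_def)
  moreover have "map2 (*) as as = map (\<lambda>x. x\<^sup>2) as"
    by (simp add: zip_same_conv_map power2_eq_square)
  ultimately have d2: "herm_decomp (einstein_prod (ctrans A) A) (map (\<lambda>x. x\<^sup>2) as) us"
    using herm_decomp_mult[OF d d] by simp
  obtain bs vs where b: "herm_decomp (tabs A) (map sqrt bs) vs"
      "mset bs = mset (herm_eigs (einstein_prod (ctrans A) A))"
    using herm_fun_decomp[OF d2, of sqrt] unfolding tabs_def by blast
  have "mset bs = filter_mset (\<lambda>x. x \<noteq> 0) (mset (map (\<lambda>x. x\<^sup>2) as))"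
    using b(2) herm_eigs_decomp(3)[OF d2] by simp
  then have "mset (map sqrt bs) = image_mset sqrt (filter_mset (\<lambda>x. x \<noteq> 0) (mset (map (\<lambda>x. x\<^sup>2) as)))"
    by simp
  also have "\<dots> = filter_mset (\<lambda>x. x \<noteq> 0) (mset as)"
    using nn by (induction as) auto
  finally have "mset (map sqrt bs) = filter_mset (\<lambda>x. x \<noteq> 0) (mset as)" .
  then have "filter_mset (\<lambda>x. x \<noteq> 0) (mset (map sqrt bs)) = filter_mset (\<lambda>x. x \<noteq> 0) (mset as)"
    by (simp only: filter_filter_mset) simp
  then show ?thesis using herm_eigs_decomp(3)[OF b(1)] by simp
qed

text \<open>Zeros among the values of \<open>f\<close> vanish from the eigenvalue list, but the
  padding restores them, and \<open>\<rho>\<close> ignores the order. The kernel of \<open>H\<close>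
  contributes zeros and not \<open>f 0\<close>.\<close>

lemma ui_norm_herm_fun:
  fixes H :: "'i::finite tensor"
  assumes d: "herm_decomp H ls us" and f: "\<And>x. 0 \<le> f x" and \<rho>: "sym_gauge \<rho> CARD('i)"
    and r: "herm_rank H \<le> CARD('i)"
  shows "ui_norm \<rho> (herm_fun f H) = \<rho> (map f (herm_eigs H) @ replicate (CARD('i) - herm_rank H) 0)"
proof -
  obtain as vs where a: "herm_decomp (herm_fun f H) (map f as) vs" "mset as = mset (herm_eigs H)"
    using herm_fun_decomp[OF d] by blast
  define E where "E = herm_eigs (tabs (herm_fun f H))"
  have E: "mset E = filter_mset (\<lambda>x. x \<noteq> 0) (image_mset f (mset (herm_eigs H)))"
    using herm_eigs_tabs[OF a(1)] f a(2) unfolding E_def by simp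
  have lenH: "length (herm_eigs H) = herm_rank H" using herm_eigs_decomp(2)[OF d] .
  have *: "filter_mset (\<lambda>x. x \<noteq> 0) M + replicate_mset (n - size (filter_mset (\<lambda>x. x \<noteq> 0) M)) 0 = M + replicate_mset (n - size M) (0::real)"
    if "size M \<le> n" for M n
    using that
  proof (induction M arbitrary: n)
    case (add x M)
    show ?case
    proof (cases "x = 0")
      case True
      have "filter_mset (\<lambda>x. x \<noteq> 0) M + replicate_mset (n - size (filter_mset (\<lambda>x. x \<noteq> 0) M)) 0 = M + replicate_mset (n - size M) (0::real)"
        using add by simp
      moreover have "replicate_mset (n - size M) (0::real) = add_mset 0 (replicate_mset (n - Suc (size M)) 0)"
        using add.prems by (metis Suc_diff_le Suc_le_eq diff_Suc_Suc replicate_mset_Suc size_add_mset)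
      ultimately show ?thesis using True by simp
    next
      case False
      then show ?thesis using add.IH[of "n - 1"] add.prems by auto
    qed
  qed simp
  have "mset (E @ replicate (CARD('i) - length E) 0) = mset (map f (herm_eigs H) @ replicate (CARD('i) - herm_rank H) 0)"
    using *[of "image_mset f (mset (herm_eigs H))" "CARD('i)"] r unfolding size_mset[symmetric] E
    by (simp add: E lenH)
  moreover have "length (map f (herm_eigs H) @ replicate (CARD('i) - herm_rank H) 0) = CARD('i)"
    using r lenH by simp
  ultimately show ?thesis
    using \<rho> unfolding ui_norm_def E_def[symmetric] sym_gauge_def by blast
qed

section \<open>Spectral decomposition\<close>

text \<open>\<open>P\<close> is the orthogonal projection onto the span of \<open>us\<close>.
  Idempotence makes each diagonal entry the sum of the squared moduli of its row, hence at most 1,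
  while the trace of \<open>P\<close> is the length of \<open>us\<close>.\<close>

lemma orthonormal_t_length_le:
  fixes us :: "'i::finite vtensor list"
  assumes "orthonormal_t us"
  shows "length us \<le> CARD('i)"
proof -
  define P :: "'i tensor" where "P = (\<lambda>i j. \<Sum>k<length us. (us ! k) i * cnj ((us ! k) j))"
  define ones where "ones = replicate (length us) (1::real)"
  have d: "herm_decomp P ones us"
    using assms by (intro herm_decompI) (auto simp: P_def ones_def)
  have "map2 (*) ones ones = ones"
    by (simp add: ones_def zip_same_conv_map map_replicate_const)
  then have "herm_decomp (einstein_prod P P) ones us"
    using herm_decomp_mult[OF d d] by simp
  then have idem: "einstein_prod P P = P"
    using d by (simp add: herm_decomp_def)
  have "Re (P i i) \<le> 1" for i
  proof -
    have "P i i = (\<Sum>j\<in>UNIV. P i j * P j i)"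
      using idem by (metis einstein_prod_def)
    also have "\<dots> = (\<Sum>j\<in>UNIV. of_real ((cmod (P i j))\<^sup>2))"
    proof (rule sum.cong[OF refl])
      fix j
      have "P j i = cnj (P i j)"
        using herm_decomp_imp_hermitian[OF d] by (metis ctrans_def hermitian_t_def)
      then show "P i j * P j i = of_real ((cmod (P i j))\<^sup>2)"
        by (simp only: complex_norm_square)
    qed
    finally have "Re (P i i) = (\<Sum>j\<in>UNIV. (cmod (P i j))\<^sup>2)" by simp
    moreover have "(cmod (P i i))\<^sup>2 \<le> (\<Sum>j\<in>UNIV. (cmod (P i j))\<^sup>2)"
      by (rule member_le_sum) auto
    moreover have "(Re (P i i))\<^sup>2 \<le> (cmod (P i i))\<^sup>2"
      using abs_Re_le_cmod by (metis abs_ge_zero power2_abs power_mono)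
    ultimately have "Re (P i i) * Re (P i i) \<le> Re (P i i) * 1" by (simp add: power2_eq_square)
    then show ?thesis by (meson linorder_not_le mult_le_cancel_left_pos order.strict_trans zero_less_one)
  qed
  then have "(\<Sum>i\<in>UNIV. Re (P i i)) \<le> (\<Sum>i\<in>(UNIV::'i set). 1)" by (rule sum_mono)
  moreover have "(\<Sum>i\<in>UNIV. Re (P i i)) = real (length us)"
    using ttrace_herm_decomp[OF d] by (simp add: ttrace_def ones_def sum_list_replicate flip: Re_sum)
  ultimately show ?thesis by simp
qed

section \<open>Inner products and existence of eigenvectors\<close>

lemma tinner_self: "tinner x x = of_real (\<Sum>i\<in>UNIV. (cmod (x i))\<^sup>2)"
  by (simp only: tinner_def complex_norm_square of_real_sum)

lemma tinner_self_eq_0: "tinner x x = 0 \<longleftrightarrow> (\<forall>i. x i = 0)"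
  unfolding tinner_self of_real_eq_0_iff by (subst sum_nonneg_eq_0_iff) auto

lemma tinner_tapply_hermitian:
  assumes "hermitian_t R"
  shows "tinner (tapply R x) y = tinner x (tapply R y)"
proof -
  have R: "cnj (R i j) = R j i" for i j
    using assms by (metis ctrans_def hermitian_t_def)
  have "tinner (tapply R x) y = (\<Sum>i\<in>UNIV. \<Sum>j\<in>UNIV. R i j * x j * cnj (y i))"
    by (simp add: tinner_def tapply_def sum_distrib_right)
  also have "\<dots> = (\<Sum>j\<in>UNIV. \<Sum>i\<in>UNIV. R i j * x j * cnj (y i))"
    by (rule sum.swap)
  also have "\<dots> = tinner x (tapply R y)"
    by (simp add: tinner_def tapply_def sum_distrib_left R mult_ac)
  finally show ?thesis .
qed

lemma tapply_scale: "tapply A (\<lambda>i. c * x i) = (\<lambda>i. c * tapply A x i)"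
  by (simp add: tapply_def sum_distrib_left mult_ac)

lemma tapply_add: "tapply A (\<lambda>i. x i + y i) = (\<lambda>i. tapply A x i + tapply A y i)"
  by (simp add: tapply_def algebra_simps sum.distrib)

lemma tinner_scale_left: "tinner (\<lambda>i. c * x i) y = c * tinner x y"
  by (simp add: tinner_def sum_distrib_left mult_ac)

lemma tinner_scale_right: "tinner x (\<lambda>i. c * y i) = cnj c * tinner x y"
  by (simp add: tinner_def sum_distrib_left mult_ac)

lemma tinner_add_left: "tinner (\<lambda>i. x i + y i) z = tinner x z + tinner y z"
  by (simp add: tinner_def algebra_simps sum.distrib)

lemma tinner_add_right: "tinner z (\<lambda>i. x i + y i) = tinner z x + tinner z y"
  by (simp add: tinner_def algebra_simps sum.distrib)

lemma tinner_normalize: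
  assumes "tinner y y \<noteq> 0"
  shows "\<exists>c. c \<noteq> 0 \<and> tinner (\<lambda>i. of_real c * y i) (\<lambda>i. of_real c * y i) = 1"
proof -
  define s where "s = (\<Sum>i\<in>UNIV. (cmod (y i))\<^sup>2)"
  have s: "tinner y y = of_real s" by (simp add: tinner_self s_def)
  have "s \<ge> 0" by (simp add: s_def sum_nonneg)
  with s assms have "s > 0" by (cases "s = 0") auto
  then have "(1 / sqrt s) * (1 / sqrt s) * s = 1" by simp
  then have "complex_of_real (1 / sqrt s) * of_real (1 / sqrt s) * of_real s = 1"
    by (metis of_real_1 of_real_mult)
  then show ?thesis
    using \<open>s > 0\<close> by (intro exI[of _ "1 / sqrt s"]) (simp add: tinner_scale_left tinner_scale_right s mult.assoc del: of_real_divide)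
qed

text \<open>The maximum over the unit sphere of \<open>complex^'i\<close> exists by compactness;
  scaling extends the bound to all \<open>y\<close>.\<close>

lemma tapply_norm_attained:
  fixes R :: "'i::finite tensor"
  shows "\<exists>x. tinner x x = 1 \<and> (\<forall>y. Re (tinner (tapply R y) (tapply R y)) \<le> Re (tinner (tapply R x) (tapply R x)) * Re (tinner y y))"
proof -
  define F where "F = (\<lambda>v::complex^'i. \<Sum>i\<in>UNIV. (cmod (\<Sum>j\<in>UNIV. R i j * v $ j))\<^sup>2)"
  have F: "F v = Re (tinner (tapply R (($) v)) (tapply R (($) v)))" for v
    by (simp add: F_def tinner_self tapply_def)
  have cont: "continuous_on (sphere 0 1) F"
    unfolding F_def by (intro continuous_intros)
  obtain e :: "complex^'i" where e: "e \<in> sphere 0 1"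
    using vector_choose_size[of 1] by (auto simp: dist_norm)
  obtain v where v: "v \<in> sphere 0 1" "\<And>w. w \<in> sphere 0 1 \<Longrightarrow> F w \<le> F v"
    using continuous_attains_sup[OF compact_sphere _ cont] e by blast
  have nrm: "w \<in> sphere 0 1 \<longleftrightarrow> tinner (($) w) (($) w) = 1" for w :: "complex^'i"
    unfolding tinner_self of_real_eq_1_iff by (simp add: norm_vec_def L2_set_def)
  have "Re (tinner (tapply R y) (tapply R y)) \<le> F v * Re (tinner y y)" for y
  proof (cases "tinner y y = 0")
    case True
    then have "tapply R y = (\<lambda>i. 0)" by (auto simp: tinner_self_eq_0 tapply_def)
    then show ?thesis using True by (simp add: tinner_self)
  next
    case False
    obtain c where c: "c \<noteq> 0" "tinner (\<lambda>i. of_real c * y i) (\<lambda>i. of_real c * y i) = 1"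
      using tinner_normalize[OF False] by blast
    have vl: "($) (\<chi> i. of_real c * y i) = (\<lambda>i. of_real c * y i)" by (simp add: fun_eq_iff)
    have "F (\<chi> i. of_real c * y i) \<le> F v"
      by (rule v(2)) (simp only: nrm vl c)
    then have 1: "c * c * Re (tinner (tapply R y) (tapply R y)) \<le> F v"
      unfolding F vl by (simp add: tapply_scale tinner_scale_left tinner_scale_right)
    have "Re (of_real c * (of_real c * tinner y y)) = 1"
      using c(2) by (simp add: tinner_scale_left tinner_scale_right)
    then have 2: "c * c * Re (tinner y y) = 1" by simp
    have "(c * c) * Re (tinner (tapply R y) (tapply R y)) \<le> (c * c) * (F v * Re (tinner y y))"
      using 1 2 by (simp add: algebra_simps)
    moreover have "c * c > 0" using c(1) by (metis not_real_square_gt_zero)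
    ultimately show ?thesis by (rule mult_left_le_imp_le)
  qed
  then show ?thesis using v(1) unfolding nrm F by blast
qed

text \<open>A unit vector \<open>x\<close> maximising \<open>\<parallel>R x\<parallel>\<^sup>2 = M\<close> satisfies \<open>R\<^sup>2 x = M x\<close>; then either
  \<open>R x + s x\<close> with \<open>s = \<surd>M\<close> is an eigenvector for \<open>s\<close>, or it vanishes and \<open>x\<close> is one for \<open>- s\<close>.\<close>

lemma hermitian_t_eigenvector:
  fixes R :: "'i::finite tensor"
  assumes h: "hermitian_t R" and nz: "R a b \<noteq> 0"
  shows "\<exists>u l. l \<noteq> 0 \<and> tinner u u = 1 \<and> tapply R u = (\<lambda>i. complex_of_real l * u i)"
proof -
  obtain x where x: "tinner x x = 1"
    and sup: "\<And>y. Re (tinner (tapply R y) (tapply R y)) \<le> Re (tinner (tapply R x) (tapply R x)) * Re (tinner y y)"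
    using tapply_norm_attained[of R] by blast
  define M where "M = Re (tinner (tapply R x) (tapply R x))"
  have M: "tinner (tapply R x) (tapply R x) = of_real M"
    by (simp add: M_def tinner_self)
  have "M > 0"
  proof -
    \<comment> \<open>The unit vector of index \<open>b\<close>, which \<open>R\<close> maps to its
      column \<open>b\<close>.\<close>
    define y :: "'i vtensor" where "y = (\<lambda>i. if i = b then 1 else 0)"
    have Ry: "tapply R y i = R i b" for i
      by (simp add: tapply_def y_def if_distrib cong: if_cong)
    have "tinner y y = 1" by (simp add: tinner_def y_def if_distrib cong: if_cong)
    then have "Re (tinner (tapply R y) (tapply R y)) \<le> M" using sup[of y] by (simp add: M_def)
    moreover have "(cmod (R a b))\<^sup>2 \<le> (\<Sum>i\<in>UNIV. (cmod (R i b))\<^sup>2)" by (rule member_le_sum) auto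
    moreover have "(cmod (R a b))\<^sup>2 > 0" using nz by simp
    ultimately show ?thesis unfolding tinner_self Ry Re_complex_of_real by linarith
  qed
  define z where "z = tapply R (tapply R x)"
  have zx: "tinner z x = of_real M" "tinner x z = of_real M"
    using M by (simp_all add: z_def tinner_tapply_hermitian[OF h, symmetric])
  \<comment> \<open>The maximality of \<open>x\<close>, tested at \<open>R x\<close>, bounds the
    squared length of \<open>z = R (R x)\<close>. Expanding the squared length of
    \<open>z - M x\<close> then leaves at most \<open>0\<close>, which forces
    \<open>z = M x\<close>.\<close>
  have "Re (tinner z z) \<le> M * M"
    using sup[of "tapply R x"] unfolding z_def M by (simp add: M_def)
  moreover define d where "d = (\<lambda>i. z i + (- of_real M) * x i)"
  have "tinner d d = tinner z z - of_real (M * M)"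
    unfolding d_def tinner_add_left tinner_add_right tinner_scale_left tinner_scale_right
    by (simp add: zx x)
  ultimately have "Re (tinner d d) \<le> 0" by simp
  moreover have "Re (tinner d d) \<ge> 0" by (simp add: tinner_self sum_nonneg)
  ultimately have "tinner d d = 0" by (simp add: tinner_self complex_eq_iff)
  then have "d i = 0" for i by (simp only: tinner_self_eq_0)
  then have z: "z = (\<lambda>i. of_real M * x i)" by (auto simp: d_def fun_eq_iff)
  define s where "s = sqrt M"
  have s: "s > 0" "M = s * s" using \<open>M > 0\<close> by (auto simp: s_def)
  define y where "y = (\<lambda>i. tapply R x i + of_real s * x i)"
  have Ry: "tapply R y = (\<lambda>i. of_real s * y i)"
    unfolding y_def tapply_add tapply_scale z_def[symmetric] z s(2) by (simp add: algebra_simps)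
  show ?thesis
  proof (cases "tinner y y = 0")
    case True
    then have "y i = 0" for i by (simp only: tinner_self_eq_0)
    then have "tapply R x = (\<lambda>i. complex_of_real (- s) * x i)"
      by (auto simp: y_def fun_eq_iff add_eq_0_iff)
    then show ?thesis using s x by (intro exI[of _ x] exI[of _ "- s"]) auto
  next
    case False
    obtain c where c: "tinner (\<lambda>i. of_real c * y i) (\<lambda>i. of_real c * y i) = 1"
      using tinner_normalize[OF False] by blast
    have "tapply R (\<lambda>i. of_real c * y i) = (\<lambda>i. complex_of_real s * (of_real c * y i))"
      unfolding tapply_scale Ry by (simp add: mult_ac)
    then show ?thesis using s c by (intro exI[of _ "\<lambda>i. of_real c * y i"] exI[of _ s]) auto
  qed
qed

lemma tapply_minus_outer:
  "tapply (\<lambda>i j. R i j - of_real l * (u i * cnj (u j))) v = (\<lambda>i. tapply R v i - of_real l * tinner v u * u i)"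
  by (simp add: tapply_def tinner_def algebra_simps sum_subtractf sum_distrib_left fun_eq_iff)

text \<open>Deflation: \<open>R\<close> is the part of \<open>H\<close> not yet decomposed, and it
  annihilates \<open>us\<close>. An eigenvector of \<open>R\<close> for a nonzero eigenvalue is
  therefore orthogonal to \<open>us\<close>; subtracting its rank-one term lengthens the list, whose
  length is at most \<open>CARD('i)\<close>.\<close>

lemma herm_decomp_extend:
  fixes H R :: "'i::finite tensor"
  assumes "hermitian_t R" "herm_decomp (\<lambda>i j. H i j - R i j) ls us"
    "\<forall>u\<in>set us. tapply R u = (\<lambda>i. 0)"
  shows "\<exists>ls us. herm_decomp H ls us"
  using assms
proof (induction "CARD('i) - length us" arbitrary: R ls us rule: less_induct)
  case less
  show ?case
  proof (cases "\<exists>a b. R a b \<noteq> 0")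
    case False
    then show ?thesis using less.prems(2) by auto
  next
    case True
    then obtain u l where u: "l \<noteq> 0" "tinner u u = 1" "tapply R u = (\<lambda>i. complex_of_real l * u i)"
      using hermitian_t_eigenvector less.prems(1) by blast
    have uv: "tinner u v = 0" if "v \<in> set us" for v
    proof -
      have "of_real l * tinner u v = tinner (tapply R u) v" by (simp add: u(3) tinner_scale_left)
      also have "\<dots> = tinner u (\<lambda>i. 0)"
        using that less.prems(3) by (simp add: tinner_tapply_hermitian[OF less.prems(1)])
      finally show ?thesis using u(1) by (simp add: tinner_def)
    qed
    have vu: "tinner v u = 0" if "v \<in> set us" for v
    proof -
      have "tinner v u = cnj (tinner u v)" by (simp add: tinner_def mult.commute)
      then show ?thesis using uv[OF that] by simp
    qed
    define R' where "R' = (\<lambda>i j. R i j - of_real l * (u i * cnj (u j)))"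
    have "cnj (R j i) = R i j" for i j
      using less.prems(1) by (metis ctrans_def hermitian_t_def)
    then have R'h: "hermitian_t R'"
      by (simp add: hermitian_t_def ctrans_def R'_def fun_eq_iff mult.commute)
    have d: "herm_decomp (\<lambda>i j. H i j - R' i j) (l # ls) (u # us)"
      using less.prems(2) u(2) uv vu by (simp add: herm_decomp_Cons_iff R'_def)
    have "length (u # us) \<le> CARD('i)"
      using d by (intro orthonormal_t_length_le) (simp add: herm_decomp_def)
    then have "CARD('i) - length (u # us) < CARD('i) - length us" by simp
    moreover have "\<forall>v\<in>set (u # us). tapply R' v = (\<lambda>i. 0)"
      using less.prems(3) u vu by (auto simp: R'_def tapply_minus_outer)
    ultimately show ?thesis using less.hyps R'h d by blast
  qed
qed

lemma hermitian_t_decomp: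
  assumes "hermitian_t H"
  shows "\<exists>ls us. herm_decomp H ls us"
proof (rule herm_decomp_extend)
  show "herm_decomp (\<lambda>i j. H i j - H i j) [] []" by (intro herm_decompI) auto
qed (use assms in auto)

lemma herm_rank_le_CARD:
  fixes H :: "'i::finite tensor"
  assumes "hermitian_t H"
  shows "herm_rank H \<le> CARD('i)"
proof -
  obtain ls us where d: "herm_decomp H ls us" using hermitian_t_decomp[OF assms] by blast
  then obtain us' where "herm_decomp H (herm_eigs H) us'" using herm_eigs_decomp(4) by blast
  then show ?thesis
    using orthonormal_t_length_le[of us'] herm_eigs_decomp(2)[OF d] by (auto simp: herm_decomp_def)
qed

text \<open>Lets the supremum in \<open>opnorm_t\<close> serve as an upper bound; the sum of the
  moduli of all entries bounds the set.\<close>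

lemma bdd_above_opnorm_t:
  fixes A :: "'i::finite tensor"
  shows "bdd_above {tvnorm (tapply A x) | x. tvnorm x \<le> 1}"
proof (rule bdd_aboveI)
  fix t assume "t \<in> {tvnorm (tapply A x) | x. tvnorm x \<le> 1}"
  then obtain x where x: "t = tvnorm (tapply A x)" "tvnorm x \<le> 1" by blast
  have x1: "cmod (x j) \<le> 1" for j
    using member_le_L2_set[of UNIV j "\<lambda>j. cmod (x j)"] x(2) unfolding tvnorm_def L2_set_def
    by (meson finite iso_tuple_UNIV_I order_trans)
  have "t \<le> (\<Sum>i\<in>UNIV. cmod (tapply A x i))"
    using L2_set_le_sum[of UNIV "\<lambda>i. cmod (tapply A x i)"] x(1) by (simp add: tvnorm_def L2_set_def)
  also have "\<dots> \<le> (\<Sum>i\<in>UNIV. \<Sum>j\<in>UNIV. cmod (A i j))"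
    unfolding tapply_def using x1
    by (intro sum_mono order_trans[OF norm_sum]) (simp add: norm_mult mult_left_le)
  finally show "t \<le> (\<Sum>i\<in>UNIV. \<Sum>j\<in>UNIV. cmod (A i j))" .
qed

text \<open>The unit vector paired with \<open>l\<close> is mapped to \<open>l\<close> times itself,
  so the modulus of \<open>l\<close> is among the values in the supremum.\<close>

lemma herm_decomp_le_opnorm:
  assumes d: "herm_decomp H ls us" and l: "l \<in> set ls"
  shows "\<bar>l\<bar> \<le> opnorm_t H"
proof -
  obtain k where k: "k < length ls" "l = ls ! k" using l by (auto simp: in_set_conv_nth)
  have on: "orthonormal_t us" and len: "length us = length ls"
    using d by (auto simp: herm_decomp_def)
  have "tapply H (us ! k) i = of_real l * (us ! k) i" for i
  proof -
    have "tapply H (us ! k) i = (\<Sum>m<length ls. of_real (ls ! m) * (us ! m) i * tinner (us ! k) (us ! m))"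
      unfolding tapply_def herm_decomp_nth[OF d] tinner_def sum_distrib_left sum_distrib_right
      by (subst sum.swap) (simp add: mult_ac)
    also have "\<dots> = (\<Sum>m<length ls. of_real (ls ! m) * (us ! m) i * (if k = m then 1 else 0))"
      using k by (intro sum.cong refl) (simp add: tinner_nth[OF on] len)
    also have "\<dots> = of_real l * (us ! k) i" using k by (simp only: sum_delta_mult)
    finally show ?thesis .
  qed
  moreover have u1: "(\<Sum>i\<in>UNIV. (cmod ((us ! k) i))\<^sup>2) = 1"
    using tinner_nth[OF on, of k k] k len unfolding tinner_self by (metis of_real_eq_1_iff)
  ultimately have "tvnorm (tapply H (us ! k)) = \<bar>l\<bar>"
    by (simp add: tvnorm_def norm_mult power_mult_distrib flip: sum_distrib_left)
  moreover have "tvnorm (us ! k) \<le> 1" using u1 by (simp add: tvnorm_def)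
  ultimately have "\<bar>l\<bar> \<in> {tvnorm (tapply H x) | x. tvnorm x \<le> 1}"
    by (metis (mono_tags, lifting) mem_Collect_eq)
  then show ?thesis
    unfolding opnorm_t_def by (intro cSup_upper bdd_above_opnorm_t)
qed

section \<open>Measurability of eigenvalues\<close>

text \<open>Continuity of \<open>D\<close> refers to the product topology on functions, hence to
  each entry; the entries of powers are polynomials in these.\<close>

lemma continuous_on_tpow_Suc:
  fixes D :: "'a::topological_space \<Rightarrow> 'i::finite tensor"
  assumes "continuous_on UNIV D"
  shows "continuous_on UNIV (\<lambda>\<tau>. tpow_Suc (D \<tau>) m i j)"
proof -
  have D: "continuous_on UNIV (\<lambda>\<tau>. D \<tau> i j)" for i j
    by (rule continuous_on_product_then_coordinatewise)
      (rule continuous_on_product_then_coordinatewise[OF assms])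
  show ?thesis
    by (induction m arbitrary: i j) (auto simp: einstein_prod_def intro!: continuous_intros D)
qed

lemma continuous_moments:
  fixes D :: "'a::topological_space \<Rightarrow> 'i::finite tensor"
  assumes h: "\<And>\<tau>. hermitian_t (D \<tau>)" and c: "continuous_on UNIV D"
  shows "continuous_on UNIV (\<lambda>\<tau>. \<Sum>x\<leftarrow>herm_eigs (D \<tau>). x ^ Suc m)"
proof -
  have "(\<Sum>x\<leftarrow>herm_eigs (D \<tau>). x ^ Suc m) = Re (\<Sum>i\<in>UNIV. tpow_Suc (D \<tau>) m i i)" for \<tau>
    using hermitian_t_decomp[OF h] herm_eigs_decomp(4) moment_eq_trace unfolding ttrace_def by metis
  then show ?thesis
    by (auto intro!: continuous_intros continuous_on_tpow_Suc[OF c])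
qed

text \<open>Polynomials in the eigenvalues are continuous in \<open>\<tau>\<close> by the moments, continuous functions of them
  are measurable by the Weierstrass theorem, and so are the counts of eigenvalues above a threshold.\<close>

lemma measurable_nth_of_moments:
  fixes X :: "'a \<Rightarrow> real list"
  assumes len: "\<And>\<tau>. \<tau> \<in> space M \<Longrightarrow> length (X \<tau>) = r"
    and bnd: "\<And>\<tau> x. \<tau> \<in> space M \<Longrightarrow> x \<in> set (X \<tau>) \<Longrightarrow> \<bar>x\<bar> \<le> B"
    and mom: "\<And>m. (\<lambda>\<tau>. \<Sum>x\<leftarrow>X \<tau>. x ^ Suc m) \<in> borel_measurable M"
    and srt: "\<And>\<tau>. \<tau> \<in> space M \<Longrightarrow> sorted_wrt (\<ge>) (X \<tau>)" and i: "i < r"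
  shows "(\<lambda>\<tau>. X \<tau> ! i) \<in> borel_measurable M"
proof -
  \<comment> \<open>The zeroth power sum is the constant length \<open>r\<close>; the others are
    given by \<open>mom\<close>.\<close>
  have pow: "(\<lambda>\<tau>. \<Sum>x\<leftarrow>X \<tau>. x ^ m) \<in> borel_measurable M" for m
  proof (cases m)
    case 0
    have "(\<lambda>\<tau>. real r) \<in> borel_measurable M" by simp
    then show ?thesis
      by (rule measurable_cong[THEN iffD1, rotated]) (simp add: 0 len sum_list_triv)
  qed (use mom in auto)
  have poly: "(\<lambda>\<tau>. \<Sum>x\<leftarrow>X \<tau>. p x) \<in> borel_measurable M" if pf: "real_polynomial_function p" for p
  proof -
    obtain a n where p: "p = (\<lambda>x. \<Sum>i\<le>n. a i * x ^ i)"
      using pf unfolding real_polynomial_function_iff_sum by blast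
    have "(\<Sum>x\<leftarrow>xs. p x) = (\<Sum>i\<le>n. a i * (\<Sum>x\<leftarrow>xs. x ^ i))" for xs
      by (induction xs) (simp_all add: p sum.distrib algebra_simps)
    then show ?thesis using pow by simp
  qed
  have cont: "(\<lambda>\<tau>. \<Sum>x\<leftarrow>X \<tau>. g x) \<in> borel_measurable M" if g: "continuous_on {- B..B} g" for g :: "real \<Rightarrow> real"
  proof -
    have "\<exists>p. real_polynomial_function p \<and> (\<forall>x\<in>{- B..B}. \<bar>g x - p x\<bar> < 1 / real (Suc n))" for n
      using Stone_Weierstrass_real_polynomial_function[OF compact_Icc g, of "1 / real (Suc n)"]
      by (metis of_nat_0_less_iff zero_less_Suc zero_less_divide_1_iff)
    then obtain p where p: "\<And>n. real_polynomial_function (p n)"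
      "\<And>n x. x \<in> {- B..B} \<Longrightarrow> \<bar>g x - p n x\<bar> < 1 / real (Suc n)" by metis
    show ?thesis
    proof (rule borel_measurable_LIMSEQ_real)
      show "(\<lambda>\<tau>. \<Sum>x\<leftarrow>X \<tau>. p n x) \<in> borel_measurable M" for n by (rule poly[OF p(1)])
      fix \<tau> assume \<tau>: "\<tau> \<in> space M"
      have "(\<lambda>n. p n x) \<longlonglongrightarrow> g x" if "x \<in> {- B..B}" for x
      proof -
        have "(\<lambda>n. p n x - g x) \<longlonglongrightarrow> 0"
        proof (rule Lim_null_comparison[OF _ LIMSEQ_inverse_real_of_nat])
          show "eventually (\<lambda>n. norm (p n x - g x) \<le> inverse (real (Suc n))) sequentially"
            using p(2)[OF that] by (intro always_eventually allI) (metis abs_minus_commute inverse_eq_divide less_imp_le real_norm_def)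
        qed
        then show ?thesis by (rule LIM_zero_cancel)
      qed
      then have "set xs \<subseteq> {- B..B} \<Longrightarrow> (\<lambda>n. \<Sum>x\<leftarrow>xs. p n x) \<longlonglongrightarrow> (\<Sum>x\<leftarrow>xs. g x)" for xs
        by (induction xs) (auto intro!: tendsto_add)
      moreover have "set (X \<tau>) \<subseteq> {- B..B}" using bnd[OF \<tau>] by (auto simp: abs_le_iff minus_le_iff)
      ultimately show "(\<lambda>n. \<Sum>x\<leftarrow>X \<tau>. p n x) \<longlonglongrightarrow> (\<Sum>x\<leftarrow>X \<tau>. g x)" by blast
    qed
  qed
  have count: "(\<lambda>\<tau>. \<Sum>x\<leftarrow>X \<tau>. if t < x then 1 else 0 :: real) \<in> borel_measurable M" for t
  proof (rule borel_measurable_LIMSEQ_real)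
    \<comment> \<open>Ramps that vanish up to \<open>t\<close> and, as \<open>n\<close> grows, reach
      1 ever closer above it. They converge pointwise to the indicator of \<open>t < x\<close>, with
      value 0 at \<open>t\<close> itself.\<close>
    define g where "g = (\<lambda>n x. min 1 (max 0 (real n * (x - t))))"
    show "(\<lambda>\<tau>. \<Sum>x\<leftarrow>X \<tau>. g n x) \<in> borel_measurable M" for n
      unfolding g_def by (intro cont continuous_intros)
    have lim: "(\<lambda>n. g n x) \<longlonglongrightarrow> (if t < x then 1 else 0)" for x
    proof (cases "t < x")
      case True
      obtain N where N: "real N * (x - t) > 1" using reals_Archimedean3[of "x - t"] True by auto
      have "eventually (\<lambda>n. g n x = 1) sequentially"
        unfolding eventually_sequentially
      proof (intro exI[of _ N] allI impI)
        fix n assume "N \<le> n"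
        then have "real N * (x - t) \<le> real n * (x - t)" using True by (intro mult_right_mono) auto
        then show "g n x = 1" using N by (simp add: g_def)
      qed
      then show ?thesis using True by (simp add: tendsto_eventually)
    next
      case False
      then have "g n x = 0" for n by (simp add: g_def mult_nonneg_nonpos)
      then show ?thesis using False by simp
    qed
    fix \<tau>
    have "(\<lambda>n. \<Sum>x\<leftarrow>xs. g n x) \<longlonglongrightarrow> (\<Sum>x\<leftarrow>xs. if t < x then 1 else 0)" for xs
    proof (induction xs)
      case (Cons a xs)
      show ?case using tendsto_add[OF lim[of a] Cons.IH] by (simp only: list.map sum_list.Cons)
    qed simp
    then show "(\<lambda>n. \<Sum>x\<leftarrow>X \<tau>. g n x) \<longlonglongrightarrow> (\<Sum>x\<leftarrow>X \<tau>. if t < x then 1 else 0)" .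
  qed
  show ?thesis
  proof (rule borel_measurableI_greater)
    fix t
    \<comment> \<open>In a decreasing list, the entry of index \<open>i\<close>, counted from zero,
      exceeds \<open>t\<close> exactly when more than \<open>i\<close> entries do.\<close>
    have "(t < X \<tau> ! i) = (real i < (\<Sum>x\<leftarrow>X \<tau>. if t < x then 1 else 0))" if \<tau>: "\<tau> \<in> space M" for \<tau>
    proof -
      define xs where "xs = X \<tau>"
      define S where "S = {k. k < r \<and> t < xs ! k}"
      have l: "length xs = r" using len \<tau> by (simp add: xs_def)
      have dec: "xs ! b \<le> xs ! a" if "a \<le> b" "b < r" for a b
        using srt[OF \<tau>] that l unfolding xs_def sorted_wrt_iff_nth_less
        by (cases "a = b") auto
      have "(\<Sum>x\<leftarrow>xs. if t < x then 1 else 0 :: real) = (\<Sum>k<r. if t < xs ! k then 1 else 0)"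
        by (simp add: sum_list_sum_nth l atLeast0LessThan)
      also have "\<dots> = real (card S)"
        by (simp add: S_def sum.If_cases Int_def)
      finally have c: "(\<Sum>x\<leftarrow>xs. if t < x then 1 else 0 :: real) = real (card S)" .
      have fin: "finite S" by (simp add: S_def)
      have "t < xs ! i \<longleftrightarrow> i < card S"
      proof
        assume "t < xs ! i"
        then have "{..i} \<subseteq> S" using dec[OF _ i] i by (auto simp: S_def intro: less_le_trans)
        then show "i < card S" using card_mono[OF fin, of "{..i}"] by simp
      next
        assume a: "i < card S"
        show "t < xs ! i"
        proof (rule ccontr)
          assume "\<not> t < xs ! i"
          have "S \<subseteq> {..<i}"
          proof
            fix k assume k: "k \<in> S"
            show "k \<in> {..<i}"
            proof (rule ccontr)
              assume "k \<notin> {..<i}"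
              then have "xs ! k \<le> xs ! i" using k by (intro dec) (auto simp: S_def)
              then show False using k \<open>\<not> t < xs ! i\<close> by (simp add: S_def)
            qed
          qed
          then show False using a card_mono[of "{..<i}" S] by simp
        qed
      qed
      then show ?thesis using c by (simp add: xs_def)
    qed
    then have "{\<tau> \<in> space M. t < X \<tau> ! i} = {\<tau> \<in> space M. real i < (\<Sum>x\<leftarrow>X \<tau>. if t < x then 1 else 0)}"
      by blast
    also have "\<dots> \<in> sets M" using count[of t] by measurable
    finally show "{\<tau> \<in> space M. t < X \<tau> ! i} \<in> sets M" .
  qed
qed

text \<open>The operator norm bounds the eigenvalues by \<open>B\<close>, and bounded measurable
  functions are integrable on a probability space.\<close>

lemma integrable_herm_eigs:
  fixes \<nu> :: "'a::metric_space measure" and D :: "'a \<Rightarrow> 'i::finite tensor"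
  assumes "prob_space \<nu>" "sets \<nu> = sets borel" "\<And>\<tau>. hermitian_t (D \<tau>)" "continuous_on UNIV D"
    "\<And>\<tau>. opnorm_t (D \<tau>) \<le> B" "\<And>\<tau>. herm_rank (D \<tau>) = r" "i < r"
  shows "integrable \<nu> (\<lambda>\<tau>. herm_eigs (D \<tau>) ! i)"
proof -
  interpret prob_space \<nu> by fact
  have len: "length (herm_eigs (D \<tau>)) = r" and srt: "sorted_wrt (\<ge>) (herm_eigs (D \<tau>))"
    and bnd: "x \<in> set (herm_eigs (D \<tau>)) \<Longrightarrow> \<bar>x\<bar> \<le> B" for \<tau> x
  proof -
    obtain ls us where d: "herm_decomp (D \<tau>) ls us" using hermitian_t_decomp assms(3) by blast
    show "length (herm_eigs (D \<tau>)) = r" "sorted_wrt (\<ge>) (herm_eigs (D \<tau>))"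
      using herm_eigs_decomp[OF d] assms(6) by auto
    show "\<bar>x\<bar> \<le> B" if "x \<in> set (herm_eigs (D \<tau>))"
      using herm_eigs_decomp(4)[OF d] herm_decomp_le_opnorm assms(5) that by (meson order_trans)
  qed
  have meas: "(\<lambda>\<tau>. herm_eigs (D \<tau>) ! i) \<in> borel_measurable \<nu>"
  proof (rule measurable_nth_of_moments[where B = B and r = r])
    show "(\<lambda>\<tau>. \<Sum>x\<leftarrow>herm_eigs (D \<tau>). x ^ Suc m) \<in> borel_measurable \<nu>" for m
      using borel_measurable_continuous_onI[OF continuous_moments[OF assms(3,4)]]
      by (simp add: measurable_def sets_eq_imp_space_eq[OF assms(2)] assms(2) cong: measurable_cong_sets)
  qed (use len srt bnd \<open>i < r\<close> in auto)
  show "integrable \<nu> (\<lambda>\<tau>. herm_eigs (D \<tau>) ! i)"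
    by (rule integrable_const_bound[where B = B]) (use meas bnd[OF nth_mem] len \<open>i < r\<close> in auto)
qed

section \<open>Symmetric gauge functions\<close>

text \<open>A hyperplane separates the strict epigraph \<open>S\<close> from the point
  \<open>(x, \<phi> x)\<close>; scaling its normal to last component \<open>- 1\<close> gives the
  subgradient.\<close>

lemma convex_subgradient:
  fixes \<phi> :: "'b::euclidean_space \<Rightarrow> real"
  assumes "convex_on UNIV \<phi>"
  shows "\<exists>w. \<forall>v. \<phi> x + inner w (v - x) \<le> \<phi> v"
proof -
  define S where "S = {(v, t). \<phi> v < t}"
  have "convex S"
  proof (rule convexI)
    fix p q and a b :: real
    assume p: "p \<in> S" and q: "q \<in> S" and ab: "0 \<le> a" "0 \<le> b" "a + b = 1"
    obtain v s u t where pq: "p = (v, s)" "q = (u, t)" "\<phi> v < s" "\<phi> u < t"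
      using p q by (auto simp: S_def)
    have "\<phi> (a *\<^sub>R v + b *\<^sub>R u) \<le> a * \<phi> v + b * \<phi> u"
      using assms ab by (simp add: convex_on_def)
    also have "\<dots> < a * s + b * t"
    proof (cases "a = 0")
      case True
      then show ?thesis using ab pq by simp
    next
      case False
      then have "a * \<phi> v < a * s" using ab pq by simp
      moreover have "b * \<phi> u \<le> b * t" using ab pq by (simp add: mult_left_mono)
      ultimately show ?thesis by linarith
    qed
    finally show "a *\<^sub>R p + b *\<^sub>R q \<in> S" by (simp add: S_def pq)
  qed
  moreover have "(x, \<phi> x + 1) \<in> S" by (simp add: S_def)
  moreover have "S \<inter> {(x, \<phi> x)} = {}" by (auto simp: S_def)
  ultimately obtain a b where ab: "a \<noteq> 0" "\<forall>p\<in>S. inner a p \<le> b" "b \<le> inner a (x, \<phi> x)"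
    using separating_hyperplane_sets[of S "{(x, \<phi> x)}"] by blast
  obtain w s where a: "a = (w, s)" by (cases a)
  have sep: "inner w v + s * t \<le> inner w x + s * \<phi> x" if "\<phi> v < t" for v t
    using ab(2,3) that by (force simp: a S_def)
  \<comment> \<open>A vertical hyperplane is impossible because \<open>S\<close> lies over the whole
    space: the point over \<open>x + w\<close> would violate the separation.\<close>
  have "s \<noteq> 0"
  proof
    assume "s = 0"
    then have "inner w (x + w) \<le> inner w x" using sep[of "x + w" "\<phi> (x + w) + 1"] by simp
    then have "inner w w \<le> 0" by (simp add: inner_right_distrib)
    then have "w = 0" by (metis inner_eq_zero_iff inner_ge_zero order.antisym)
    then show False using \<open>s = 0\<close> ab(1) a by (simp add: zero_prod_def)
  qed
  moreover have "s \<le> 0" using sep[of x "\<phi> x + 1"] by (simp add: algebra_simps)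
  ultimately have s: "s < 0" by simp
  have "\<phi> x + inner ((1 / (- s)) *\<^sub>R w) (v - x) \<le> \<phi> v" for v
  proof -
    \<comment> \<open>\<open>S\<close> contains only points strictly above the graph, whence the
      \<open>\<epsilon>\<close>.\<close>
    have "\<phi> x + inner w (v - x) / (- s) \<le> \<phi> v + \<epsilon>" if "\<epsilon> > 0" for \<epsilon>
    proof -
      have "inner w v + s * (\<phi> v + \<epsilon>) \<le> inner w x + s * \<phi> x" using sep that by simp
      then have "inner w (v - x) \<le> (\<phi> v + \<epsilon> - \<phi> x) * (- s)" by (simp add: inner_diff_right algebra_simps)
      then have "inner w (v - x) / (- s) \<le> \<phi> v + \<epsilon> - \<phi> x" using s by (subst pos_divide_le_eq) auto
      then show ?thesis by simp
    qed
    then have "\<phi> x + inner w (v - x) / (- s) \<le> \<phi> v" by (rule field_le_epsilon)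
    then show ?thesis by simp
  qed
  then show ?thesis by (intro exI allI)
qed

text \<open>Summation by parts: the prefix sums \<open>P\<close> of \<open>b - a\<close> are
  nonnegative and are weighted by the nonnegative decrements of \<open>d\<close>. The last weight
  may have any sign, but the total \<open>P r\<close> is zero.\<close>

lemma sum_mult_le_of_prefix_sums:
  fixes a b d :: "nat \<Rightarrow> real"
  assumes d: "\<And>i j. i \<le> j \<Longrightarrow> j < r \<Longrightarrow> d j \<le> d i"
    and le: "\<And>k. k < r \<Longrightarrow> (\<Sum>i<k. a i) \<le> (\<Sum>i<k. b i)"
    and eq: "(\<Sum>i<r. a i) = (\<Sum>i<r. b i)"
  shows "(\<Sum>i<r. d i * a i) \<le> (\<Sum>i<r. d i * b i)"
proof (cases r)
  case (Suc m)
  define P where "P = (\<lambda>k. \<Sum>i<k. b i - a i)"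
  have P: "P k \<ge> 0" if "k \<le> r" for k
    using that le[of k] eq by (cases "k = r") (auto simp: P_def sum_subtractf)
  have "d k * P (Suc k) \<le> (\<Sum>i<Suc k. d i * (b i - a i))" if "k < r" for k
    using that
  proof (induction k)
    case (Suc k)
    have "d (Suc k) * P (Suc k) \<le> d k * P (Suc k)"
      using Suc.prems by (intro mult_right_mono d P) auto
    moreover have "d k * P (Suc k) \<le> (\<Sum>i<Suc k. d i * (b i - a i))" using Suc by simp
    ultimately show ?case by (simp add: P_def algebra_simps)
  qed (simp add: P_def)
  from this[of m] have "0 \<le> (\<Sum>i<r. d i * (b i - a i))"
    using Suc eq by (simp add: P_def sum_subtractf)
  then show ?thesis by (simp add: algebra_simps sum_subtractf)
qed simp

text \<open>After subtracting \<open>V m\<close> with \<open>m = card A - 1\<close>, terms beyond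
  \<open>m\<close> are at most zero and those up to \<open>m\<close> are nonnegative, so passing
  from \<open>A\<close> to \<open>{..m}\<close> cannot decrease the sum.\<close>

lemma sum_le_sum_lessThan_card:
  fixes V :: "nat \<Rightarrow> real"
  assumes V: "\<And>i j. i \<le> j \<Longrightarrow> j < r \<Longrightarrow> V j \<le> V i" and A: "A \<subseteq> {..<r}"
  shows "sum V A \<le> (\<Sum>i<card A. V i)"
proof (cases "card A")
  case 0
  then show ?thesis using A finite_subset by fastforce
next
  case (Suc m)
  have fin: "finite A" using A finite_subset by blast
  have "card A \<le> r" using card_mono[OF _ A] by simp
  then have m: "m < r" using Suc by simp
  have "(\<Sum>j\<in>A. V j - V m) \<le> (\<Sum>j\<in>A. if j \<in> {..m} then V j - V m else 0)"
    using A V[of m] by (intro sum_mono) auto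
  also have "\<dots> = (\<Sum>j\<in>A \<inter> {..m}. V j - V m)" using fin by (simp add: sum.inter_restrict)
  also have "\<dots> \<le> (\<Sum>j\<le>m. V j - V m)" using V m by (intro sum_mono2) auto
  finally show ?thesis using Suc by (simp add: sum_subtractf lessThan_Suc_atMost)
qed

lemma exists_decreasing_permutation:
  fixes W :: "nat \<Rightarrow> 'b::linorder"
  shows "\<exists>p. p permutes {..<r} \<and> (\<forall>i j. i \<le> j \<longrightarrow> j < r \<longrightarrow> W (p j) \<le> W (p i))"
proof -
  define xs where "xs = map W [0..<r]"
  have len: "length xs = r" by (simp add: xs_def)
  have "mset (rev (sort xs)) = mset xs" by simp
  then obtain p where p: "p permutes {..<r}" "permute_list p xs = rev (sort xs)"
    using mset_eq_permutation len by metis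
  have "W (p k) = rev (sort xs) ! k" if "k < r" for k
    using that p permutes_in_image[OF p(1), of k]
    by (simp add: p(2)[symmetric] permute_list_nth len) (simp add: xs_def)
  moreover have "sorted_wrt (\<ge>) (rev (sort xs))" by (simp add: sorted_wrt_rev)
  ultimately have "W (p j) \<le> W (p i)" if "i \<le> j" "j < r" for i j
    using that len by (cases "i = j") (auto simp: sorted_wrt_iff_nth_less)
  then show ?thesis using p(1) by blast
qed

text \<open>A form of the rearrangement inequality. The first \<open>k\<close> values of
  \<open>W\<close> sit at \<open>k\<close> distinct places of the sorted sequence, so their sum is
  at most that of its first \<open>k\<close> values.\<close>

lemma sum_mult_decreasing_permutation_le:
  fixes W x :: "nat \<Rightarrow> real"
  assumes p: "p permutes {..<r}" and Wp: "\<And>i j. i \<le> j \<Longrightarrow> j < r \<Longrightarrow> W (p j) \<le> W (p i)"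
    and x: "\<And>i j. i \<le> j \<Longrightarrow> j < r \<Longrightarrow> x j \<le> x i"
  shows "(\<Sum>k<r. W k * x k) \<le> (\<Sum>k<r. W (p k) * x k)"
proof -
  have "(\<Sum>k<r. x k * W k) \<le> (\<Sum>k<r. x k * W (p k))"
  proof (rule sum_mult_le_of_prefix_sums)
    fix k assume k: "k < r"
    have "inj_on (inv p) {..<k}" using p permutes_inv permutes_inj_on by blast
    then have "(\<Sum>j\<in>inv p ` {..<k}. W (p j)) = (\<Sum>i<k. W i)" and "card (inv p ` {..<k}) = k"
      by (simp_all only: sum.reindex comp_def permutes_inverses(1)[OF p] card_image card_lessThan)
    moreover have "inv p ` {..<k} \<subseteq> inv p ` {..<r}" using k by (intro image_mono) auto
    then have "inv p ` {..<k} \<subseteq> {..<r}" by (simp only: permutes_image[OF permutes_inv[OF p]])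
    ultimately show "(\<Sum>i<k. W i) \<le> (\<Sum>i<k. W (p i))"
      using sum_le_sum_lessThan_card[of r "\<lambda>j. W (p j)" "inv p ` {..<k}"] Wp by simp
  next
    show "(\<Sum>i<r. W i) = (\<Sum>i<r. W (p i))" by (rule sum.permute[OF p, unfolded comp_def])
  qed (use x in auto)
  then show ?thesis by (simp add: mult.commute)
qed

locale symmetric_gauge =
  fixes \<rho> :: "real list \<Rightarrow> real" and n :: nat
  assumes sym_gauge: "sym_gauge \<rho> n"
begin

text \<open>Functions on indices replace lists, so that vector operations are pointwise; only the
  values below \<open>n\<close> count.\<close>

definition gauge :: "(nat \<Rightarrow> real) \<Rightarrow> real" where
  "gauge g = \<rho> (map g [0..<n])"

lemma gauge_cong: "(\<And>k. k < n \<Longrightarrow> g k = h k) \<Longrightarrow> gauge g = gauge h"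
  unfolding gauge_def by (rule arg_cong[of _ _ \<rho>]) simp

lemma gauge_scale: "gauge (\<lambda>k. c * g k) = \<bar>c\<bar> * gauge g"
proof -
  have "length (map g [0..<n]) = n" by simp
  then have "\<rho> (map ((*) c) (map g [0..<n])) = \<bar>c\<bar> * \<rho> (map g [0..<n])"
    using sym_gauge unfolding sym_gauge_def by blast
  then show ?thesis by (simp add: gauge_def comp_def)
qed

lemma gauge_add: "gauge (\<lambda>k. g k + h k) \<le> gauge g + gauge h"
proof -
  have "length (map g [0..<n]) = n" "length (map h [0..<n]) = n" by simp_all
  then have "\<rho> (map2 (+) (map g [0..<n]) (map h [0..<n])) \<le> \<rho> (map g [0..<n]) + \<rho> (map h [0..<n])"
    using sym_gauge unfolding sym_gauge_def by blast
  then show ?thesis by (simp add: gauge_def map2_map_map)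
qed

lemma gauge_sign:
  assumes "\<And>k. e k = 1 \<or> e k = -1"
  shows "gauge (\<lambda>k. e k * g k) = gauge g"
proof -
  have "length (map g [0..<n]) = n" "length (map e [0..<n]) = n" "set (map e [0..<n]) \<subseteq> {-1, 1}"
    using assms by auto
  then have "\<rho> (map2 (*) (map e [0..<n]) (map g [0..<n])) = \<rho> (map g [0..<n])"
    using sym_gauge unfolding sym_gauge_def by blast
  then show ?thesis by (simp add: gauge_def map2_map_map)
qed

lemma gauge_permute:
  assumes p: "p permutes {..<n}"
  shows "gauge (\<lambda>k. g (p k)) = gauge g"
proof -
  have "image_mset p (mset_set {0..<n}) = mset_set {0..<n}"
    using permutes_image[OF p] permutes_inj_on[OF p, of "{0..<n}"]
    by (simp add: image_mset_mset_set atLeast0LessThan)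
  then have "image_mset g (image_mset p (mset_set {0..<n})) = image_mset g (mset_set {0..<n})"
    by (rule arg_cong)
  then have "mset (map (\<lambda>k. g (p k)) [0..<n]) = mset (map g [0..<n])"
    by (simp add: image_mset.compositionality comp_def)
  moreover have "length (map g [0..<n]) = n" by simp
  ultimately show ?thesis
    using sym_gauge unfolding sym_gauge_def gauge_def by blast
qed

text \<open>Shrinking one coordinate by a factor \<open>s \<in> [0, 1]\<close> is averaging with its sign change.\<close>

lemma gauge_mono:
  assumes xy: "\<And>k. k < n \<Longrightarrow> 0 \<le> x k \<and> x k \<le> y k"
  shows "gauge x \<le> gauge y"
proof -
  \<comment> \<open>\<open>h\<close> passes from \<open>y\<close> at \<open>m = 0\<close> to
    \<open>x\<close> at \<open>m = n\<close>, one coordinate at a time.\<close>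
  define h where "h = (\<lambda>m k. if k < m then x k else y k)"
  have "gauge (h m) \<le> gauge y" if "m \<le> n" for m
    using that
  proof (induction m)
    case 0
    then show ?case by (simp add: h_def)
  next
    case (Suc m)
    \<comment> \<open>For \<open>y m = 0\<close> the quotient is 0 by convention, and then
      \<open>x m = 0\<close> as well.\<close>
    define s where "s = x m / y m"
    define e :: "nat \<Rightarrow> real" where "e = (\<lambda>k. if k = m then -1 else 1)"
    have xm: "0 \<le> x m" "x m \<le> y m" using xy[of m] Suc.prems by auto
    then have s: "0 \<le> s" "s \<le> 1" "s * y m = x m"
      by (auto simp: s_def divide_le_eq)
    have "h (Suc m) k = (1 + s) / 2 * h m k + (1 - s) / 2 * (e k * h m k)" for k
    proof (cases "k = m")
      case True
      have "(1 + s) / 2 * y m + (1 - s) / 2 * (- 1 * y m) = s * y m" by (simp add: field_simps)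
      then show ?thesis using True s by (simp add: h_def e_def)
    next
      case False
      then show ?thesis by (auto simp: h_def e_def field_simps)
    qed
    then have "gauge (h (Suc m)) = gauge (\<lambda>k. (1 + s) / 2 * h m k + (1 - s) / 2 * (e k * h m k))"
      by (intro gauge_cong)
    also have "\<dots> \<le> gauge (\<lambda>k. (1 + s) / 2 * h m k) + gauge (\<lambda>k. (1 - s) / 2 * (e k * h m k))"
      by (rule gauge_add)
    also have "\<dots> = \<bar>(1 + s) / 2\<bar> * gauge (h m) + \<bar>(1 - s) / 2\<bar> * gauge (\<lambda>k. e k * h m k)"
      by (simp only: gauge_scale)
    also have "gauge (\<lambda>k. e k * h m k) = gauge (h m)"
      by (rule gauge_sign) (simp add: e_def)
    also have "\<bar>(1 + s) / 2\<bar> * gauge (h m) + \<bar>(1 - s) / 2\<bar> * gauge (h m) = (1 + s) / 2 * gauge (h m) + (1 - s) / 2 * gauge (h m)"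
      using s by simp
    also have "\<dots> = gauge (h m)" by (simp add: field_simps)
    finally show ?case using Suc by simp
  qed
  from this[of n] show ?thesis using gauge_cong[of "h n" x] by (simp add: h_def)
qed

text \<open>Convexity of \<open>f\<close> in each coordinate passes through
  \<open>gauge_mono\<close>, which uses the nonnegativity of \<open>f\<close>, and then through the
  triangle inequality. \<open>E\<close> numbers the coordinates of \<open>real^'i\<close>, a
  Euclidean space where subgradients are available.\<close>

lemma convex_on_gauge:
  fixes E :: "nat \<Rightarrow> 'i::finite"
  assumes f: "convex_on UNIV f" "\<And>x. 0 \<le> f x"
  shows "convex_on UNIV (\<lambda>v::real^'i. gauge (\<lambda>k. if k < r then f (v $ E k) else 0))"
proof (rule convex_onI)
  fix t and u v :: "real^'i" assume t: "0 < t" "t < (1::real)"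
  let ?F = "\<lambda>v k. if k < r then f (v $ E k) else 0"
  have "f (((1 - t) *\<^sub>R u + t *\<^sub>R v) $ E k) \<le> (1 - t) * f (u $ E k) + t * f (v $ E k)" for k
    using convex_onD[OF f(1), of t "u $ E k" "v $ E k"] t by simp
  then have "gauge (?F ((1 - t) *\<^sub>R u + t *\<^sub>R v)) \<le> gauge (\<lambda>k. (1 - t) * ?F u k + t * ?F v k)"
    using f(2) by (intro gauge_mono) auto
  also have "\<dots> \<le> gauge (\<lambda>k. (1 - t) * ?F u k) + gauge (\<lambda>k. t * ?F v k)" by (rule gauge_add)
  also have "\<dots> = (1 - t) * gauge (?F u) + t * gauge (?F v)"
    using t by (simp add: gauge_scale)
  finally show "gauge (?F ((1 - t) *\<^sub>R u + t *\<^sub>R v)) \<le> (1 - t) * gauge (?F u) + t * gauge (?F v)" .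
qed simp

end

text \<open>For \<open>k\<close> up to the length of \<open>x\<close> this is the Ky Fan
  \<open>k\<close>-norm, the sum of the \<open>k\<close> largest moduli. The infimum over thresholds
  \<open>t\<close> gives the gauge properties without sorting.\<close>

definition ky_fan :: "nat \<Rightarrow> real list \<Rightarrow> real" where
  "ky_fan k x = (INF t\<in>{0..}. real k * t + (\<Sum>a\<leftarrow>x. max (\<bar>a\<bar> - t) 0))"

lemma ky_fan_le:
  assumes "0 \<le> t"
  shows "ky_fan k x \<le> real k * t + (\<Sum>a\<leftarrow>x. max (\<bar>a\<bar> - t) 0)"
  unfolding ky_fan_def
proof (rule cINF_lower)
  show "bdd_below ((\<lambda>t. real k * t + (\<Sum>a\<leftarrow>x. max (\<bar>a\<bar> - t) 0)) ` {0..})"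
    by (rule bdd_belowI[of _ 0]) (auto intro!: add_nonneg_nonneg sum_list_nonneg)
qed (use assms in auto)

lemma le_ky_fan:
  assumes "\<And>t. 0 \<le> t \<Longrightarrow> c \<le> real k * t + (\<Sum>a\<leftarrow>x. max (\<bar>a\<bar> - t) 0)"
  shows "c \<le> ky_fan k x"
  unfolding ky_fan_def by (rule cINF_greatest) (use assms in auto)

text \<open>A threshold \<open>t\<close> for \<open>x\<close> becomes
  \<open>\<bar>c\<bar> * t\<close> for the scaled list.\<close>

lemma ky_fan_scale_le: "ky_fan k (map ((*) c) x) \<le> \<bar>c\<bar> * ky_fan k x"
proof (cases "c = 0")
  case True
  have "(\<Sum>a\<leftarrow>map ((*) c) x. max (\<bar>a\<bar> - 0) 0) = 0" using True by (induction x) auto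
  then show ?thesis using ky_fan_le[of 0 k "map ((*) c) x"] True by simp
next
  case False
  have "ky_fan k (map ((*) c) x) / \<bar>c\<bar> \<le> ky_fan k x"
  proof (rule le_ky_fan)
    fix t :: real assume t: "0 \<le> t"
    have "max (\<bar>c * a\<bar> - \<bar>c\<bar> * t) 0 = \<bar>c\<bar> * max (\<bar>a\<bar> - t) 0" for a
      by (simp add: max_mult_distrib_left abs_mult right_diff_distrib)
    then have "(\<Sum>a\<leftarrow>map ((*) c) x. max (\<bar>a\<bar> - \<bar>c\<bar> * t) 0) = \<bar>c\<bar> * (\<Sum>a\<leftarrow>x. max (\<bar>a\<bar> - t) 0)"
      by (simp add: comp_def sum_list_const_mult)
    then have "ky_fan k (map ((*) c) x) \<le> \<bar>c\<bar> * (real k * t + (\<Sum>a\<leftarrow>x. max (\<bar>a\<bar> - t) 0))"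
      using ky_fan_le[of "\<bar>c\<bar> * t" k "map ((*) c) x"] t by (simp add: algebra_simps)
    then show "ky_fan k (map ((*) c) x) / \<bar>c\<bar> \<le> real k * t + (\<Sum>a\<leftarrow>x. max (\<bar>a\<bar> - t) 0)"
      using False by (simp add: divide_le_eq mult.commute)
  qed
  then show ?thesis using False by (simp add: divide_le_eq mult.commute)
qed

text \<open>For nonzero \<open>c\<close>, the converse bound is \<open>ky_fan_scale_le\<close> with
  the factor \<open>1 / c\<close>.\<close>

lemma ky_fan_scale: "ky_fan k (map ((*) c) x) = \<bar>c\<bar> * ky_fan k x"
proof (rule antisym[OF ky_fan_scale_le])
  show "\<bar>c\<bar> * ky_fan k x \<le> ky_fan k (map ((*) c) x)"
  proof (cases "c = 0")
    case True
    have "0 \<le> ky_fan k (map ((*) c) x)"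
      by (rule le_ky_fan) (auto intro!: add_nonneg_nonneg sum_list_nonneg)
    then show ?thesis using True by simp
  next
    case False
    have "map ((*) (1 / c)) (map ((*) c) x) = x" using False by (simp add: comp_def)
    then have "ky_fan k x \<le> \<bar>1 / c\<bar> * ky_fan k (map ((*) c) x)"
      using ky_fan_scale_le[of k "1 / c" "map ((*) c) x"] by simp
    then show ?thesis using False by (simp add: field_simps)
  qed
qed

text \<open>Thresholds \<open>t\<close> and \<open>s\<close> for the summands add up to a threshold
  for the sum; the two infima are then taken one after the other.\<close>

lemma ky_fan_add:
  assumes "length x = length y"
  shows "ky_fan k (map2 (+) x y) \<le> ky_fan k x + ky_fan k y"
proof -
  have 1: "ky_fan k (map2 (+) x y) \<le>
      (real k * t + (\<Sum>a\<leftarrow>x. max (\<bar>a\<bar> - t) 0)) + (real k * s + (\<Sum>a\<leftarrow>y. max (\<bar>a\<bar> - s) 0))"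
    if "0 \<le> t" "0 \<le> s" for t s
  proof -
    have "(\<Sum>a\<leftarrow>map2 (+) x y. max (\<bar>a\<bar> - (t + s)) 0) \<le> (\<Sum>a\<leftarrow>x. max (\<bar>a\<bar> - t) 0) + (\<Sum>a\<leftarrow>y. max (\<bar>a\<bar> - s) 0)"
      using assms
    proof (induction x y rule: list_induct2)
      case (Cons a x b y)
      have "max (\<bar>a + b\<bar> - (t + s)) 0 \<le> max (\<bar>a\<bar> - t) 0 + max (\<bar>b\<bar> - s) 0" by (auto simp: max_def)
      then show ?case using Cons.IH unfolding zip_Cons_Cons list.map sum_list.Cons prod.case by linarith
    qed simp
    then show ?thesis using ky_fan_le[of "t + s" k "map2 (+) x y"] that by (simp add: algebra_simps)
  qed
  have "ky_fan k (map2 (+) x y) - (real k * t + (\<Sum>a\<leftarrow>x. max (\<bar>a\<bar> - t) 0)) \<le> ky_fan k y" if "0 \<le> t" for t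
    using 1[OF that] by (intro le_ky_fan) (simp add: algebra_simps)
  then have "ky_fan k (map2 (+) x y) - ky_fan k y \<le> ky_fan k x"
    by (intro le_ky_fan) (simp add: algebra_simps)
  then show ?thesis by simp
qed

lemma abs_le_ky_fan:
  assumes "1 \<le> k" "a \<in> set x"
  shows "\<bar>a\<bar> \<le> ky_fan k x"
proof (rule le_ky_fan)
  fix t :: real assume "0 \<le> t"
  then have "1 * t \<le> real k * t" using assms(1) by (intro mult_right_mono) auto
  moreover have "max (\<bar>a\<bar> - t) 0 \<le> (\<Sum>a\<leftarrow>x. max (\<bar>a\<bar> - t) 0)"
    using assms(2) by (intro member_le_sum_list) auto
  ultimately show "\<bar>a\<bar> \<le> real k * t + (\<Sum>a\<leftarrow>x. max (\<bar>a\<bar> - t) 0)" by linarith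
qed

lemma sym_gauge_ky_fan:
  assumes k: "1 \<le> k"
  shows "sym_gauge (ky_fan k) n"
  unfolding sym_gauge_def
proof (intro conjI allI impI)
  fix x show "0 \<le> ky_fan k x"
    by (rule le_ky_fan) (auto intro!: add_nonneg_nonneg sum_list_nonneg)
  show "ky_fan k x = 0 \<longleftrightarrow> (\<forall>a\<in>set x. a = 0)"
  proof
    assume "ky_fan k x = 0"
    then show "\<forall>a\<in>set x. a = 0" using abs_le_ky_fan[OF k, of _ x] by fastforce
  next
    assume "\<forall>a\<in>set x. a = 0"
    then have "map ((*) 0) x = x" by (simp add: map_idI)
    then show "ky_fan k x = 0" using ky_fan_scale[of k 0 x] by simp
  qed
next
  fix x :: "real list" and c show "ky_fan k (map ((*) c) x) = \<bar>c\<bar> * ky_fan k x" by (rule ky_fan_scale)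
next
  fix x y :: "real list" assume "length x = n" "length y = n"
  then show "ky_fan k (map2 (+) x y) \<le> ky_fan k x + ky_fan k y" by (intro ky_fan_add) simp
next
  fix x y :: "real list" assume "mset y = mset x"
  then have "(\<Sum>a\<leftarrow>y. max (\<bar>a\<bar> - t) 0) = (\<Sum>a\<leftarrow>x. max (\<bar>a\<bar> - t) 0)" for t
    by (metis mset_map sum_mset_sum_list)
  then show "ky_fan k y = ky_fan k x" by (simp add: ky_fan_def)
next
  fix x e :: "real list" assume "length x = n" "length e = n" "set e \<subseteq> {-1, 1}"
  then have "length e = length x" "set e \<subseteq> {-1, 1}" by auto
  then have "(\<Sum>a\<leftarrow>map2 (*) e x. max (\<bar>a\<bar> - t) 0) = (\<Sum>a\<leftarrow>x. max (\<bar>a\<bar> - t) 0)" for t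
    by (induction e x rule: list_induct2) auto
  then show "ky_fan k (map2 (*) e x) = ky_fan k x" by (simp add: ky_fan_def)
qed

text \<open>A threshold between the first \<open>k\<close> entries and the moduli of the rest
  attains the infimum. Every threshold \<open>s\<close> gives at least the sum, as positive parts
  dominate \<open>x ! i - s\<close>.\<close>

lemma ky_fan_eq_sum:
  assumes k: "k \<le> length x" and t: "0 \<le> t"
    and hi: "\<And>i. i < k \<Longrightarrow> t \<le> x ! i" and lo: "\<And>i. k \<le> i \<Longrightarrow> i < length x \<Longrightarrow> \<bar>x ! i\<bar> \<le> t"
  shows "ky_fan k x = (\<Sum>i<k. x ! i)"
proof (rule antisym)
  have split: "(\<Sum>a\<leftarrow>x. max (\<bar>a\<bar> - s) 0) = (\<Sum>i<k. max (\<bar>x ! i\<bar> - s) 0) + (\<Sum>i=k..<length x. max (\<bar>x ! i\<bar> - s) 0)" for s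
    using k by (simp add: sum_list_sum_nth lessThan_atLeast0 sum.atLeastLessThan_concat)
  have "(\<Sum>i=k..<length x. max (\<bar>x ! i\<bar> - t) 0) = 0" using lo by (intro sum.neutral) auto
  moreover have "(\<Sum>i<k. max (\<bar>x ! i\<bar> - t) 0) = (\<Sum>i<k. x ! i - t)"
    using hi t by (intro sum.cong refl) force
  ultimately show "ky_fan k x \<le> (\<Sum>i<k. x ! i)"
    using ky_fan_le[OF t, of k x] split[of t] by (simp add: sum_subtractf)
  show "(\<Sum>i<k. x ! i) \<le> ky_fan k x"
  proof (rule le_ky_fan)
    fix s :: real
    have "(\<Sum>i<k. x ! i - s) \<le> (\<Sum>i<k. max (\<bar>x ! i\<bar> - s) 0)" by (intro sum_mono) auto
    moreover have "0 \<le> (\<Sum>i=k..<length x. max (\<bar>x ! i\<bar> - s) 0)" by (intro sum_nonneg) auto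
    ultimately show "(\<Sum>i<k. x ! i) \<le> real k * s + (\<Sum>a\<leftarrow>x. max (\<bar>a\<bar> - s) 0)"
      unfolding split by (simp add: sum_subtractf)
  qed
qed

section \<open>Majorization and norms\<close>

text \<open>The permutation sorting the subgradient at \<open>x\<close> does not depend on \<open>\<tau>\<close>, so the linear lower bound for
  \<open>\<phi> (V (L \<tau>))\<close> can be integrated; this does Jensen's inequality and the passage along the majorization
  in one step.\<close>

lemma (in symmetric_gauge) gauge_le_integral_gauge:
  fixes L :: "'a \<Rightarrow> nat \<Rightarrow> real" and x :: "nat \<Rightarrow> real" and E :: "nat \<Rightarrow> 'i::finite"
  assumes "prob_space \<nu>" and f: "convex_on UNIV f" "\<And>x. 0 \<le> f x" and E: "bij_betw E {..<n} UNIV"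
    and rn: "r \<le> n"
    and int: "\<And>k. k < r \<Longrightarrow> integrable \<nu> (\<lambda>\<tau>. L \<tau> k)"
    and bnd: "\<And>\<tau> k. k < r \<Longrightarrow> \<bar>L \<tau> k\<bar> \<le> B"
    and Ldec: "\<And>\<tau> i j. i \<le> j \<Longrightarrow> j < r \<Longrightarrow> L \<tau> j \<le> L \<tau> i"
    and xdec: "\<And>i j. i \<le> j \<Longrightarrow> j < r \<Longrightarrow> x j \<le> x i"
    and le: "\<And>k. k < r \<Longrightarrow> (\<Sum>i<k. x i) \<le> (\<Sum>i<k. \<integral>\<tau>. L \<tau> i \<partial>\<nu>)"
    and eq: "(\<Sum>i<r. x i) = (\<Sum>i<r. \<integral>\<tau>. L \<tau> i \<partial>\<nu>)"
  shows "gauge (\<lambda>k. if k < r then f (x k) else 0) \<le> (\<integral>\<tau>. gauge (\<lambda>k. if k < r then f (L \<tau> k) else 0) \<partial>\<nu>)"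
proof -
  interpret prob_space \<nu> by fact
  define \<phi> where "\<phi> = (\<lambda>v::real^'i. gauge (\<lambda>k. if k < r then f (v $ E k) else 0))"
  \<comment> \<open>Coordinates numbered \<open>r\<close> or higher are set to 0, so that inner
    products with \<open>V g\<close> run over \<open>k < r\<close> only.\<close>
  define V :: "(nat \<Rightarrow> real) \<Rightarrow> real^'i" where
    "V g = (\<chi> i. let k = inv_into {..<n} E i in if k < r then g k else 0)" for g
  have VE: "V g $ E k = (if k < r then g k else 0)" if "k < n" for g k
    using inv_into_f_f[of E "{..<n}" k] E that by (simp add: V_def bij_betw_def)
  have \<phi>V: "\<phi> (V g) = gauge (\<lambda>k. if k < r then f (g k) else 0)" for g
    unfolding \<phi>_def by (intro gauge_cong) (simp add: VE)
  have inner_V: "inner w (V g) = (\<Sum>k<r. w $ E k * g k)" for w g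
  proof -
    have "inner w (V g) = (\<Sum>i\<in>E ` {..<n}. w $ i * V g $ i)"
      using E by (simp add: inner_vec_def bij_betw_def)
    also have "\<dots> = (\<Sum>k<n. w $ E k * V g $ E k)"
      using E by (subst sum.reindex) (auto simp: bij_betw_def)
    also have "\<dots> = (\<Sum>k<n. if k \<in> {..<r} then w $ E k * g k else 0)"
      by (intro sum.cong refl) (simp add: VE)
    also have "\<dots> = (\<Sum>k\<in>{..<n} \<inter> {..<r}. w $ E k * g k)"
      by (simp add: sum.inter_restrict)
    also have "{..<n} \<inter> {..<r} = {..<r}" using rn by auto
    finally show ?thesis .
  qed
  have cvx: "convex_on UNIV \<phi>" unfolding \<phi>_def by (rule convex_on_gauge[OF f])
  have cont: "continuous_on UNIV \<phi>" by (rule convex_on_continuous[OF open_UNIV cvx])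
  obtain w where w: "\<And>v. \<phi> (V x) + inner w (v - V x) \<le> \<phi> v"
    using convex_subgradient[OF cvx] by blast
  define W where "W = (\<lambda>k. w $ E k)"
  obtain p where p: "p permutes {..<r}" and Wp: "\<And>i j. i \<le> j \<Longrightarrow> j < r \<Longrightarrow> W (p j) \<le> W (p i)"
    using exists_decreasing_permutation[of r W] by blast
  define q where "q = inv p"
  have q: "q permutes {..<r}" unfolding q_def by (rule permutes_inv[OF p])
  \<comment> \<open>\<open>q\<close> fixes the padding indices from \<open>r\<close> on, so the
    symmetry of the gauge in all \<open>n\<close> coordinates applies to it.\<close>
  have qn: "q permutes {..<n}" using permutes_subset[OF q] rn by auto
  have qr: "q k < r \<longleftrightarrow> k < r" for k using permutes_in_image[OF q, of k] by simp
  \<comment> \<open>The tangent at \<open>V x\<close> is evaluated at the permuted vector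
    \<open>Z\<close>: \<open>\<phi>\<close> does not notice the permutation, while the linear part
    pairs \<open>L \<tau>\<close> with the decreasing weights \<open>W (p k)\<close>.\<close>
  have lower: "\<phi> (V x) + ((\<Sum>k<r. W (p k) * L \<tau> k) - (\<Sum>k<r. W k * x k)) \<le> \<phi> (V (L \<tau>))" for \<tau>
  proof -
    define Z where "Z = (\<lambda>k. L \<tau> (q k))"
    have "\<phi> (V Z) = gauge (\<lambda>k. (\<lambda>k. if k < r then f (L \<tau> k) else 0) (q k))"
      by (simp add: \<phi>V Z_def qr)
    also have "\<dots> = \<phi> (V (L \<tau>))" unfolding \<phi>V by (rule gauge_permute[OF qn])
    finally have "\<phi> (V Z) = \<phi> (V (L \<tau>))" .
    moreover have "inner w (V Z) = (\<Sum>k<r. W (p k) * L \<tau> k)"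
    proof -
      have "inner w (V Z) = (\<Sum>k<r. W k * L \<tau> (q k))" by (simp add: inner_V W_def Z_def)
      also have "\<dots> = (\<Sum>k<r. W (p k) * L \<tau> (q (p k)))"
        by (rule sum.permute[OF p, unfolded comp_def])
      finally show ?thesis by (simp add: q_def permutes_inverses(2)[OF p])
    qed
    ultimately show ?thesis using w[of "V Z"] by (simp add: inner_diff_right inner_V W_def)
  qed
  have int\<phi>: "integrable \<nu> (\<lambda>\<tau>. \<phi> (V (L \<tau>)))"
  proof -
    have VL: "V (L \<tau>) \<in> cbox (\<chi> i. - \<bar>B\<bar>) (\<chi> i. \<bar>B\<bar>)" for \<tau>
    proof -
      have "\<bar>L \<tau> k\<bar> \<le> \<bar>B\<bar>" if "k < r" for k using order_trans[OF bnd[OF that] abs_ge_self] .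
      then show ?thesis by (auto simp: mem_box_cart V_def Let_def abs_le_iff minus_le_iff)
    qed
    \<comment> \<open>The box is compact and contains every \<open>V (L \<tau>)\<close>, so
      continuity of \<open>\<phi>\<close> gives a bound uniform in \<open>\<tau>\<close>.\<close>
    have "bounded (\<phi> ` cbox (\<chi> i. - \<bar>B\<bar>) (\<chi> i. \<bar>B\<bar>))"
      by (intro compact_imp_bounded compact_continuous_image continuous_on_subset[OF cont]) auto
    then obtain K where "\<And>v. v \<in> cbox (\<chi> i. - \<bar>B\<bar>) (\<chi> i. \<bar>B\<bar>) \<Longrightarrow> norm (\<phi> v) \<le> K"
      unfolding bounded_iff by blast
    then have "AE \<tau> in \<nu>. norm (\<phi> (V (L \<tau>))) \<le> K" using VL by auto
    moreover have "(\<lambda>\<tau>. V (L \<tau>)) \<in> borel_measurable \<nu>"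
    proof (subst borel_measurable_euclidean_space, intro ballI)
      fix b :: "real^'i" assume "b \<in> Basis"
      then obtain i where b: "b = axis i 1" by (auto simp: Basis_vec_def)
      have "(\<lambda>\<tau>. V (L \<tau>) $ i) \<in> borel_measurable \<nu>"
        by (cases "inv_into {..<n} E i < r") (auto simp: V_def Let_def borel_measurable_integrable[OF int])
      then show "(\<lambda>\<tau>. inner (V (L \<tau>)) b) \<in> borel_measurable \<nu>"
        by (simp add: b inner_axis)
    qed
    then have "(\<lambda>\<tau>. \<phi> (V (L \<tau>))) \<in> borel_measurable \<nu>"
      using borel_measurable_continuous_onI[OF cont] by (rule measurable_compose)
    ultimately show ?thesis by (intro integrable_const_bound)
  qed
  have intW: "integrable \<nu> (\<lambda>\<tau>. \<Sum>k<r. W (p k) * L \<tau> k)"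
    by (intro Bochner_Integration.integrable_sum integrable_mult_right int) auto
  \<comment> \<open>Sorting the weights cannot decrease the sum, since \<open>x\<close> is
    decreasing; \<open>le\<close> and \<open>eq\<close> then replace \<open>x\<close> by the
    integrals.\<close>
  have "(\<Sum>k<r. W k * x k) \<le> (\<Sum>k<r. W (p k) * x k)"
    using sum_mult_decreasing_permutation_le[OF p, of W x] Wp xdec by blast
  also have "\<dots> \<le> (\<Sum>k<r. W (p k) * (\<integral>\<tau>. L \<tau> k \<partial>\<nu>))"
    using sum_mult_le_of_prefix_sums[of r "\<lambda>k. W (p k)" x "\<lambda>k. \<integral>\<tau>. L \<tau> k \<partial>\<nu>"] Wp le eq by blast
  also have "\<dots> = (\<integral>\<tau>. (\<Sum>k<r. W (p k) * L \<tau> k) \<partial>\<nu>)"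
    using int by (subst Bochner_Integration.integral_sum) auto
  finally have "\<phi> (V x) \<le> \<phi> (V x) + ((\<integral>\<tau>. (\<Sum>k<r. W (p k) * L \<tau> k) \<partial>\<nu>) - (\<Sum>k<r. W k * x k))"
    by simp
  also have "\<dots> = (\<integral>\<tau>. \<phi> (V x) + ((\<Sum>k<r. W (p k) * L \<tau> k) - (\<Sum>k<r. W k * x k)) \<partial>\<nu>)"
    using intW by (simp add: prob_space)
  also have "\<dots> \<le> (\<integral>\<tau>. \<phi> (V (L \<tau>)) \<partial>\<nu>)"
    using lower int\<phi> intW by (intro integral_mono) auto
  finally show ?thesis unfolding \<phi>V .
qed

lemma convex_on_max_affine: "convex_on UNIV (\<lambda>x::real. max (a * x + b) 0)"
proof (rule convex_onI)
  fix t x y :: real assume t: "0 < t" "t < 1"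
  have "a * ((1 - t) * x + t * y) + b = (1 - t) * (a * x + b) + t * (a * y + b)"
    by (simp add: algebra_simps)
  also have "\<dots> \<le> (1 - t) * max (a * x + b) 0 + t * max (a * y + b) 0"
    using t by (intro add_mono mult_left_mono) auto
  finally show "max (a * ((1 - t) *\<^sub>R x + t *\<^sub>R y) + b) 0 \<le> (1 - t) * max (a * x + b) 0 + t * max (a * y + b) 0"
    using t by simp
qed simp

theorem theorem3p2:
  fixes \<nu> :: "'a::metric_space measure"
    and C :: "'i::finite tensor"
    and D :: "'a \<Rightarrow> 'i tensor"
    and r :: nat
  assumes "sigma_compact_space TYPE('a)"
    and "prob_space \<nu>" and "sets \<nu> = sets borel"
    and "hermitian_t C" and "\<forall>\<tau>. hermitian_t (D \<tau>)"
    and "continuous_on UNIV D"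
    and "bdd_above (range (\<lambda>\<tau>. opnorm_t (D \<tau>)))"
    and "herm_rank C = r" and "\<forall>\<tau>. herm_rank (D \<tau>) = r"
  shows "majorized (herm_eigs C)
            (map (\<lambda>i. \<integral>\<tau>. herm_eigs (D \<tau>) ! i \<partial>\<nu>) [0..<r])
         \<longleftrightarrow>
         (\<forall>f :: real \<Rightarrow> real. convex_on UNIV f \<and> (\<forall>x. 0 \<le> f x) \<longrightarrow>
            (\<forall>\<rho>. sym_gauge \<rho> CARD('i) \<longrightarrow>
               ui_norm \<rho> (herm_fun f C) \<le> (\<integral>\<tau>. ui_norm \<rho> (herm_fun f (D \<tau>)) \<partial>\<nu>)))"
    (is "?maj \<longleftrightarrow> ?norms")
proof -
  interpret prob_space \<nu> by fact
  define n where "n = CARD('i)"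
  obtain B0 where B0: "\<And>\<tau>. opnorm_t (D \<tau>) \<le> B0"
    using assms(7) by (auto simp: bdd_above_def)
  \<comment> \<open>\<open>B\<close> dominates the moduli of all eigenvalues of \<open>C\<close> and
    of every \<open>D \<tau>\<close>, so \<open>x + B\<close> and \<open>B - x\<close> are
    nonnegative there.\<close>
  define B where "B = max B0 (opnorm_t C)"
  have BD: "opnorm_t (D \<tau>) \<le> B" for \<tau> using B0[of \<tau>] by (simp add: B_def)
  \<comment> \<open>The predicate lets the facts below be proved once for \<open>C\<close> and all
    \<open>D \<tau>\<close>.\<close>
  define admissible where "admissible = (\<lambda>H::'i tensor. hermitian_t H \<and> herm_rank H = r \<and> opnorm_t H \<le> B)"
  have adm: "admissible C" "admissible (D \<tau>)" for \<tau>
    using assms BD by (auto simp: admissible_def B_def)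
  have rn: "r \<le> n" using herm_rank_le_CARD[OF assms(4)] assms(8) by (simp add: n_def)
  have len: "length (herm_eigs H) = r"
    and dec: "\<And>i j. i \<le> j \<Longrightarrow> j < r \<Longrightarrow> herm_eigs H ! j \<le> herm_eigs H ! i"
    and bnd: "\<And>k. k < r \<Longrightarrow> \<bar>herm_eigs H ! k\<bar> \<le> B"
    and ui: "\<And>f \<rho>. (\<And>x. 0 \<le> f x) \<Longrightarrow> sym_gauge \<rho> n \<Longrightarrow>
      ui_norm \<rho> (herm_fun f H) = \<rho> (map f (herm_eigs H) @ replicate (n - r) 0)" if "admissible H" for H
  proof -
    have H: "hermitian_t H" "herm_rank H = r" "opnorm_t H \<le> B" using that by (auto simp: admissible_def)
    obtain ls us where d: "herm_decomp H ls us" using hermitian_t_decomp[OF H(1)] by blast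
    show l: "length (herm_eigs H) = r" using herm_eigs_decomp(2)[OF d] H(2) by simp
    show "herm_eigs H ! j \<le> herm_eigs H ! i" if "i \<le> j" "j < r" for i j
      using herm_eigs_decomp(1)[OF d] that l by (cases "i = j") (auto simp: sorted_wrt_iff_nth_less)
    show "\<bar>herm_eigs H ! k\<bar> \<le> B" if "k < r" for k
      using herm_eigs_decomp(4)[OF d] herm_decomp_le_opnorm[OF _ nth_mem, of H "herm_eigs H"] that l H(3)
      by fastforce
    show "ui_norm \<rho> (herm_fun f H) = \<rho> (map f (herm_eigs H) @ replicate (n - r) 0)"
      if "\<And>x. 0 \<le> f x" "sym_gauge \<rho> n" for f \<rho>
      using ui_norm_herm_fun[OF d, of f \<rho>] that rn H(2) by (simp add: n_def)
  qed
  define y where "y = (\<lambda>i. \<integral>\<tau>. herm_eigs (D \<tau>) ! i \<partial>\<nu>)"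
  have hD: "hermitian_t (D \<tau>)" "herm_rank (D \<tau>) = r" for \<tau> using assms(5,9) by auto
  note eigs_int = integrable_herm_eigs[OF assms(2,3) hD(1) assms(6) BD hD(2)]
  \<comment> \<open>The range of \<open>k\<close> is widened to 0, where both sums are empty, and to
    \<open>r\<close>, where equality of the totals gives the inequality.\<close>
  have maj_iff: "?maj \<longleftrightarrow> (\<forall>k\<le>r. (\<Sum>i<k. herm_eigs C ! i) \<le> (\<Sum>i<k. y i)) \<and> (\<Sum>i<r. herm_eigs C ! i) = (\<Sum>i<r. y i)"
  proof -
    have take_C: "sum_list (take k (herm_eigs C)) = (\<Sum>i<k. herm_eigs C ! i)" if "k \<le> r" for k
      using that len[OF adm(1)] by (simp add: sum_list_sum_nth atLeast0LessThan)
    have take_y: "sum_list (take k (map y [0..<r])) = (\<Sum>i<k. y i)" if "k \<le> r" for k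
      using that by (simp add: sum_list_sum_nth atLeast0LessThan)
    have "?maj \<longleftrightarrow> (\<forall>k. 1 \<le> k \<and> k < r \<longrightarrow> (\<Sum>i<k. herm_eigs C ! i) \<le> (\<Sum>i<k. y i)) \<and> (\<Sum>i<r. herm_eigs C ! i) = (\<Sum>i<r. y i)"
      unfolding majorized_def y_def[symmetric] using take_C take_y take_C[of r] take_y[of r] len[OF adm(1)]
      by auto
    also have "\<dots> \<longleftrightarrow> (\<forall>k\<le>r. (\<Sum>i<k. herm_eigs C ! i) \<le> (\<Sum>i<k. y i)) \<and> (\<Sum>i<r. herm_eigs C ! i) = (\<Sum>i<r. y i)"
      (is "?a \<and> ?e \<longleftrightarrow> ?b \<and> ?e")
    proof -
      have "(\<Sum>i<k. herm_eigs C ! i) \<le> (\<Sum>i<k. y i)" if "?a" "?e" "k \<le> r" for k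
        using that by (cases "k = 0 \<or> k = r") auto
      then show ?thesis by auto
    qed
    finally show ?thesis .
  qed
  show ?thesis
  proof
    assume maj: ?maj
    have prefix: "(\<Sum>i<k. herm_eigs C ! i) \<le> (\<Sum>i<k. \<integral>\<tau>. herm_eigs (D \<tau>) ! i \<partial>\<nu>)" if "k < r" for k
      using maj that unfolding maj_iff y_def by simp
    have total: "(\<Sum>i<r. herm_eigs C ! i) = (\<Sum>i<r. \<integral>\<tau>. herm_eigs (D \<tau>) ! i \<partial>\<nu>)"
      using maj unfolding maj_iff y_def by simp
    show ?norms
    proof (intro allI impI, elim conjE)
      fix f :: "real \<Rightarrow> real" and \<rho>
      assume f: "convex_on UNIV f" "\<forall>x. 0 \<le> f x" and \<rho>: "sym_gauge \<rho> CARD('i)"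
      interpret symmetric_gauge \<rho> n using \<rho> by unfold_locales (simp add: n_def)
      obtain E where E: "bij_betw E {..<n} (UNIV :: 'i set)"
        using ex_bij_betw_nat_finite[of "UNIV :: 'i set"] by (auto simp: n_def atLeast0LessThan)
      have g: "ui_norm \<rho> (herm_fun f H) = gauge (\<lambda>k. if k < r then f (herm_eigs H ! k) else 0)" if "admissible H" for H
      proof -
        have "map f (herm_eigs H) @ replicate (n - r) 0 = map (\<lambda>k. if k < r then f (herm_eigs H ! k) else 0) [0..<n]"
          using len[OF that] rn by (intro nth_equalityI) (auto simp: nth_append)
        then show ?thesis using ui[OF that] f(2) sym_gauge by (simp add: gauge_def)
      qed
      show "ui_norm \<rho> (herm_fun f C) \<le> (\<integral>\<tau>. ui_norm \<rho> (herm_fun f (D \<tau>)) \<partial>\<nu>)"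
        unfolding g[OF adm(1)] g[OF adm(2)]
        by (rule gauge_le_integral_gauge[OF assms(2) f(1) _ E rn eigs_int bnd[OF adm(2)] dec[OF adm(2)] dec[OF adm(1)] prefix total])
          (use f(2) in auto)
    qed
  next
    assume norms: ?norms
    have ineq: "\<rho> (map f (herm_eigs C) @ replicate (n - r) 0) \<le> (\<integral>\<tau>. \<rho> (map f (herm_eigs (D \<tau>)) @ replicate (n - r) 0) \<partial>\<nu>)"
      if "convex_on UNIV f" "\<And>x. 0 \<le> f x" "sym_gauge \<rho> n" for f \<rho>
      using norms that ui[OF adm(1)] ui[OF adm(2)] by (simp add: n_def)
    have sum_int: "(\<integral>\<tau>. (\<Sum>i<k. a * herm_eigs (D \<tau>) ! i + B) \<partial>\<nu>) = (\<Sum>i<k. a * y i + B)" if "k \<le> r" for k a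
    proof -
      have "(\<integral>\<tau>. (\<Sum>i<k. a * herm_eigs (D \<tau>) ! i + B) \<partial>\<nu>) = (\<Sum>i<k. \<integral>\<tau>. a * herm_eigs (D \<tau>) ! i + B \<partial>\<nu>)"
        using eigs_int that by (intro Bochner_Integration.integral_sum) auto
      also have "\<dots> = (\<Sum>i<k. a * y i + B)"
        using eigs_int that by (intro sum.cong refl) (simp add: y_def prob_space)
      finally show ?thesis .
    qed
    have "(\<Sum>i<k. herm_eigs C ! i) \<le> (\<Sum>i<k. y i)" if k: "1 \<le> k" "k \<le> r" for k
    proof -
      \<comment> \<open>At the eigenvalues the maximum is just \<open>x + B\<close>; it serves to
        make \<open>?f\<close> nonnegative everywhere.\<close>
      let ?f = "\<lambda>x. max (1 * x + B) 0"
      have val: "ky_fan k (map ?f (herm_eigs H) @ replicate (n - r) 0) = (\<Sum>i<k. 1 * herm_eigs H ! i + B)"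
        if H: "admissible H" for H
      proof -
        \<comment> \<open>The \<open>k\<close>-th largest shifted eigenvalue separates the first
          \<open>k\<close> entries from the later ones and from the padding.\<close>
        let ?t = "herm_eigs H ! (k - 1) + B"
        have pos: "0 \<le> herm_eigs H ! i + B" if "i < r" for i using bnd[OF H that] by (simp add: abs_le_iff)
        have "ky_fan k (map ?f (herm_eigs H) @ replicate (n - r) 0) = (\<Sum>i<k. (map ?f (herm_eigs H) @ replicate (n - r) 0) ! i)"
        proof (rule ky_fan_eq_sum)
          show "k \<le> length (map ?f (herm_eigs H) @ replicate (n - r) 0)" using k len[OF H] by simp
          show "0 \<le> ?t" using k by (intro pos) auto
          show "?t \<le> (map ?f (herm_eigs H) @ replicate (n - r) 0) ! i" if "i < k" for i
            using that k dec[OF H, of i "k - 1"] len[OF H] by (auto simp: nth_append le_max_iff_disj)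
          show "\<bar>(map ?f (herm_eigs H) @ replicate (n - r) 0) ! i\<bar> \<le> ?t"
            if "k \<le> i" "i < length (map ?f (herm_eigs H) @ replicate (n - r) 0)" for i
            using that k dec[OF H, of "k - 1" i] len[OF H] pos[of i] pos[of "k - 1"] by (cases "i < r") (auto simp: nth_append)
        qed
        also have "\<dots> = (\<Sum>i<k. 1 * herm_eigs H ! i + B)"
          using k len[OF H] pos by (intro sum.cong refl) (auto simp: nth_append)
        finally show ?thesis .
      qed
      have "(\<Sum>i<k. 1 * herm_eigs C ! i + B) \<le> (\<Sum>i<k. 1 * y i + B)"
        using ineq[OF convex_on_max_affine[of 1 B] _ sym_gauge_ky_fan[OF k(1)]] unfolding val[OF adm(1)] val[OF adm(2)] sum_int[OF k(2)] by simp
      then show ?thesis by (simp add: sum.distrib)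
    qed
    moreover have "(\<Sum>i<r. y i) \<le> (\<Sum>i<r. herm_eigs C ! i)"
    \<comment> \<open>\<open>ky_fan 0\<close> is not a gauge, so the case of empty sums is set
      apart.\<close>
    proof (cases "r = 0")
      case False
      then have r: "1 \<le> r" by simp
      let ?f = "\<lambda>x. max (- 1 * x + B) 0"
      have val: "ky_fan r (map ?f (herm_eigs H) @ replicate (n - r) 0) = (\<Sum>i<r. - 1 * herm_eigs H ! i + B)"
        if H: "admissible H" for H
      proof -
        have pos: "0 \<le> - 1 * herm_eigs H ! i + B" if "i < r" for i using bnd[OF H that] by (simp add: abs_le_iff)
        \<comment> \<open>The values now come in increasing order, but with \<open>k = r\<close> all
          of them count, and the threshold 0 separates them from the padding.\<close>
        have "ky_fan r (map ?f (herm_eigs H) @ replicate (n - r) 0) = (\<Sum>i<r. (map ?f (herm_eigs H) @ replicate (n - r) 0) ! i)"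
          by (rule ky_fan_eq_sum[where t = 0]) (use len[OF H] in \<open>auto simp: nth_append\<close>)
        also have "\<dots> = (\<Sum>i<r. - 1 * herm_eigs H ! i + B)"
          using len[OF H] pos by (intro sum.cong refl) (auto simp: nth_append)
        finally show ?thesis .
      qed
      have "(\<Sum>i<r. - 1 * herm_eigs C ! i + B) \<le> (\<Sum>i<r. - 1 * y i + B)"
        using ineq[OF convex_on_max_affine[of "- 1" B] _ sym_gauge_ky_fan[OF r]] unfolding val[OF adm(1)] val[OF adm(2)] sum_int[OF order_refl] by simp
      then show ?thesis by (simp add: sum.distrib sum_subtractf)
    qed simp
    ultimately show ?maj
      unfolding maj_iff by (metis antisym less_one linorder_not_le lessThan_0 order_refl sum.empty)
  qed
qed

end
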